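(* Let $n\ge 3$ and $2\le p<n$. There exist a vector-function $b_0\in L_p(B_{1/2})$, $b_0:B_{1/2}\to\mathbb{R}^n$, with $\operatorname{div} b_0=0$, and a scalar function $u_0\in W_2^1(B_{1/2})\cap L_\infty(B_{1/2})$ such that $-\Delta u_0+b_0\cdot\nabla u_0=0$ in $B_{1/2}$ (in the weak sense), but $u_0\notin C(B_{1/2})$.
   Context: $B_R$ is the ball in $\mathbb{R}^n$ of radius $R$ centered at the origin. $W_2^1$ is the Sobolev space of functions with weak first derivatives in $L_2$. The condition $\operatorname{div} b=0$ is understood in the sense of distributions. The equation $-\Delta u+b\cdot\nabla u=0$ in $B_R$ is understood in the sense of the integral identity $$\int_{B_R}\nabla u\cdot(\nabla h+b\,h)\,dx=0\qquad\text{for all }h\in C_0^\infty(B_R).$$ $u_0\notin C(B_{1/2})$ means that $u_0$ does not coincide almost everywhere with a continuous function on $B_{1/2}$. *)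

theory Defs
  imports "HOL-Analysis.Analysis"
begin

text \<open>
  Function spaces on an open set \<open>S\<close> are sets of total functions; only the values on \<open>S\<close>, up to
  Lebesgue null sets, matter for membership (except for test functions, which are taken to be
  extended by zero outside \<open>S\<close>).
\<close>

definition Lp_on :: "real \<Rightarrow> 'a::euclidean_space set \<Rightarrow> ('a \<Rightarrow> 'b::euclidean_space) set" where
  "Lp_on p S = {f \<in> borel_measurable (lebesgue_on S).
                  integrable (lebesgue_on S) (\<lambda>x. norm (f x) powr p)}"

definition Linf_on :: "'a::euclidean_space set \<Rightarrow> ('a \<Rightarrow> 'b::euclidean_space) set" where
  "Linf_on S = {f \<in> borel_measurable (lebesgue_on S).
                  \<exists>C. AE x in lebesgue_on S. norm (f x) \<le> C}"

definition locally_integrable_on :: "('a::euclidean_space \<Rightarrow> 'b::euclidean_space) \<Rightarrow> 'a set \<Rightarrow> bool"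
  where
  "locally_integrable_on f S \<longleftrightarrow>
     (\<forall>K. compact K \<and> K \<subseteq> S \<longrightarrow> f absolutely_integrable_on K)"

text \<open>\<open>k\<close> times continuously differentiable functions on the whole space.\<close>

primrec C_k :: "nat \<Rightarrow> ('a::euclidean_space \<Rightarrow> real) \<Rightarrow> bool" where
  "C_k 0 f \<longleftrightarrow> continuous_on UNIV f"
| "C_k (Suc k) f \<longleftrightarrow>
     (\<forall>x. f differentiable (at x)) \<and> (\<forall>v. C_k k (\<lambda>x. frechet_derivative f (at x) v))"

definition test_functions :: "'a::euclidean_space set \<Rightarrow> ('a \<Rightarrow> real) set" where
  "test_functions S = {h. (\<forall>k. C_k k h) \<and> compact (closure {x. h x \<noteq> 0}) \<and>
                          closure {x. h x \<noteq> 0} \<subseteq> S}"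

definition grad :: "('a::euclidean_space \<Rightarrow> real) \<Rightarrow> 'a \<Rightarrow> 'a" where
  "grad h x = (\<Sum>i\<in>Basis. frechet_derivative h (at x) i *\<^sub>R i)"

definition weak_gradient_on ::
  "'a::euclidean_space set \<Rightarrow> ('a \<Rightarrow> real) \<Rightarrow> ('a \<Rightarrow> 'a) \<Rightarrow> bool" where
  "weak_gradient_on S u g \<longleftrightarrow>
     locally_integrable_on u S \<and> locally_integrable_on g S \<and>
     (\<forall>h\<in>test_functions S.
        (\<integral>x. u x *\<^sub>R grad h x \<partial>lebesgue_on S) = - (\<integral>x. h x *\<^sub>R g x \<partial>lebesgue_on S))"

definition W12_on :: "'a::euclidean_space set \<Rightarrow> ('a \<Rightarrow> real) set" where
  "W12_on S = {u \<in> Lp_on 2 S. \<exists>g\<in>Lp_on 2 S. weak_gradient_on S u g}"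

text \<open>
  The integral of a non-integrable function is \<open>0\<close> by convention, so the two integral identities
  below are stated with \<^const>\<open>has_bochner_integral\<close>, which includes integrability.
\<close>

definition weakly_div_free_on :: "'a::euclidean_space set \<Rightarrow> ('a \<Rightarrow> 'a) \<Rightarrow> bool" where
  "weakly_div_free_on S b \<longleftrightarrow>
     (\<forall>h\<in>test_functions S. has_bochner_integral (lebesgue_on S) (\<lambda>x. b x \<bullet> grad h x) 0)"

text \<open>
  Weak solutions of \<open>-\<Delta>u + b \<cdot> \<nabla>u = 0\<close> in an open set \<open>S\<close>. The weak gradient \<open>g\<close> of \<open>u\<close> is unique up
  to a null set, so it is immaterial which one is used.
\<close>

definition weak_solution_on ::
  "'a::euclidean_space set \<Rightarrow> ('a \<Rightarrow> 'a) \<Rightarrow> ('a \<Rightarrow> real) \<Rightarrow> bool" where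
  "weak_solution_on S b u \<longleftrightarrow>
     (\<exists>g. weak_gradient_on S u g \<and>
        (\<forall>h\<in>test_functions S.
           has_bochner_integral (lebesgue_on S) (\<lambda>x. g x \<bullet> (grad h x + h x *\<^sub>R b x)) 0))"

definition ae_continuous_on :: "'a::euclidean_space set \<Rightarrow> ('a \<Rightarrow> real) \<Rightarrow> bool" where
  "ae_continuous_on S u \<longleftrightarrow>
     (\<exists>v. continuous_on S v \<and> (AE x in lebesgue_on S. u x = v x))"

end

theory Submission
  imports Defs
begin

text \<open>
  Write \<open>R = |x|\<close> and single out a coordinate \<open>z\<close>. The solution is \<open>u = z (1 + R^d) / R\<close> with a small
  \<open>d > 0\<close>; it tends to \<open>1\<close> and \<open>-1\<close> along the two halves of the \<open>z\<close>-axis. Pick two more coordinates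
  \<open>x1\<close>, \<open>x2\<close>, put \<open>\<sigma> = x1^2 + x2^2\<close>, and treat \<open>q = R^2 - z^2 - \<sigma>\<close> as a parameter. The drift is the
  axisymmetric field in the variables \<open>(x1, x2, z)\<close> with stream function \<open>\<psi>\<close>, so it is the divergence
  of the skew-symmetric field with entries \<open>\<plusminus> x_i \<psi> / \<sigma>\<close>. In the coordinates \<open>(R, u, q)\<close> the equation
  \<open>b \<cdot> \<nabla>u = \<Delta>u\<close> reads \<open>\<partial>\<psi>/\<partial>R = u M'(R)\<close>; in any dimension \<open>M'\<close> depends on \<open>R\<close> only, because the
  stream function lives on a three-dimensional slice. Regularity on the axis \<open>\<sigma> = 0\<close> forces
  \<open>\<psi> = u (M(R) - M(R'))\<close>, where \<open>R'\<close> is the radius at which the level set of \<open>u\<close> with the same \<open>q\<close>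
  meets the axis (\<open>0\<close> if it ends at the origin). On the axis \<open>u\<close> grows only like \<open>R^d\<close>, and this costs
  the drift a factor \<open>R^(-d)\<close> compared with scaling: \<open>|b| \<le> C R^(-1-d)\<close>, which is in \<open>L_p\<close> for small
  \<open>d\<close>. The singularity at the origin is too weak to be seen by the weak formulations.
\<close>

section \<open>Integration by parts for singular functions\<close>

text \<open>Subtracting a function of \<open>u\<close> and \<open>q\<close> from the stream function
  does not change the product of the drift with the gradient of \<open>u\<close>. This freedom makes
  \<open>\<psi>\<close> vanish on the axis, where the potential divides by \<open>\<sigma>\<close>.
  It is also why \<open>z / R\<close> would not do for \<open>u\<close>: that function is constant
  along each half-axis, whereas the factor \<open>1 + R^d\<close> makes \<open>u\<close> strictly
  monotone there, so that a level determines its radius on the axis. The price is a division by a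
  derivative that can be as small as \<open>d R^d / R\<close>. The delicate place is the surface
  \<open>u^2 = 1\<close> for \<open>q = 0\<close>, where the levels change from meeting the axis to
  ending at the origin; in dimension \<open>3\<close> there is no other value of \<open>q\<close>.
  Only first derivatives of \<open>\<psi>\<close> are at hand, so the drift is never differentiated:
  the divergence condition is tested on the potential, and the mixed second derivatives of the test
  function cancel. The potential and the gradient of \<open>u\<close> are \<open>O(1/R)\<close> and
  their relevant derivatives \<open>O(1/R^2)\<close>, which is integrable from dimension
  \<open>3\<close> on.\<close>

lemma integrable_norm_powr_ball:
  fixes \<beta> :: real
  assumes "0 \<le> \<beta>" "\<beta> < DIM('a::euclidean_space)"
  shows "integrable lborel (\<lambda>x::'a. indicator (ball 0 1) x * norm x powr (-\<beta>))"
proof (rule integrableI_bounded)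
  let ?c = "measure lborel (ball (0::'a) 1)"
  let ?B = "\<lambda>k::nat. ball (0::'a) ((1/2)^k)"
  let ?a = "\<lambda>k::nat. (2 ^ Suc k) powr \<beta>"
  \<comment> \<open>Dyadic majorant: a point with \<open>2^-(k+1) \<le> |x| < 2^-k\<close> lies in
    the \<open>k\<close>-th ball, and there \<open>|x|^-\<beta>\<close> is at most
    \<open>2^((k+1)\<beta>)\<close>. Integrating the majorant gives a geometric series with ratio
    \<open>2^(\<beta> - n)\<close>, \<open>n\<close> being the dimension.\<close>
  have pt: "ennreal (norm (indicator (ball 0 1) x * norm x powr (-\<beta>)))
      \<le> (\<Sum>k. ennreal (?a k) * indicator (?B k) x)" if x: "x \<noteq> 0" for x :: 'a
  proof (cases "norm x < 1")
    case True
    obtain N where N: "(1/2)^N < norm x"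
      using real_arch_pow_inv[of "norm x" "1/2"] x by auto
    define k where "k = (LEAST k. (1/2::real)^(Suc k) \<le> norm x)"
    have "(1/2)^(Suc N) \<le> norm x" using N power_decreasing[of N "Suc N" "1/2::real"] by linarith
    hence k: "(1/2)^(Suc k) \<le> norm x" unfolding k_def by (rule LeastI)
    have kB: "x \<in> ?B k"
    proof (cases k)
      case (Suc l)
      have "\<not> (1/2)^(Suc l) \<le> norm x"
        using not_less_Least[of l "\<lambda>k. (1/2::real)^(Suc k) \<le> norm x"] Suc k_def by auto
      thus ?thesis using Suc by simp
    qed (use True in simp)
    have "norm x powr (-\<beta>) \<le> ((1/2)^(Suc k)) powr (-\<beta>)"
      using k assms by (intro powr_mono2') auto
    also have "\<dots> = ?a k" by (simp add: powr_minus power_one_over powr_divide)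
    finally have "ennreal (norm (indicator (ball 0 1) x * norm x powr (-\<beta>))) \<le> ennreal (?a k) * indicator (?B k) x"
      using True kB by (simp add: ennreal_leI)
    also have "\<dots> \<le> (\<Sum>k. ennreal (?a k) * indicator (?B k) x)"
    proof -
      have "f k \<le> suminf f" for f :: "nat \<Rightarrow> ennreal"
        using sum_le_suminf[OF summableI, of "{k}" f] by simp
      thus ?thesis .
    qed
    finally show ?thesis .
  qed (simp add: indicator_def)
  have "AE x in lborel. x \<noteq> (0::'a)" by (rule AE_lborel_singleton)
  hence "(\<integral>\<^sup>+x. ennreal (norm (indicator (ball 0 1) x * norm (x::'a) powr (-\<beta>))) \<partial>lborel)
      \<le> (\<integral>\<^sup>+x. (\<Sum>k. ennreal (?a k) * indicator (?B k) x) \<partial>lborel)"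
    by (intro nn_integral_mono_AE) (erule eventually_mono, rule pt)
  also have "\<dots> = (\<Sum>k. (\<integral>\<^sup>+x. ennreal (?a k) * indicator (?B k) x \<partial>lborel))"
    by (rule nn_integral_suminf)
      (intro borel_measurable_times_ennreal borel_measurable_const borel_measurable_indicator; simp)
  also have "\<dots> = (\<Sum>k. ennreal (2 powr \<beta> * ?c * (2 powr (\<beta> - DIM('a)))^k))"
  proof (intro suminf_cong)
    fix k
    have "(\<integral>\<^sup>+x. ennreal (?a k) * indicator (?B k) x \<partial>lborel) = ennreal (?a k) * emeasure lborel (?B k)"
      by (subst nn_integral_cmult_indicator) auto
    also have "emeasure lborel (?B k) = ennreal (measure lborel (?B k))"
      using emeasure_lborel_ball_finite[of "0::'a" "(1/2)^k"] by (subst emeasure_eq_ennreal_measure) auto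
    also have "measure lborel (?B k) = ((1/2)^k) ^ DIM('a) * ?c"
      by (rule content_ball_conv_unit_ball) simp
    also have "ennreal (?a k) * ennreal (((1/2)^k) ^ DIM('a) * ?c) = ennreal (?a k * (((1/2)^k) ^ DIM('a) * ?c))"
      by (rule ennreal_mult[symmetric]) auto
    also have "?a k * (((1/2)^k) ^ DIM('a) * ?c) = 2 powr \<beta> * ?c * (2 powr (\<beta> - DIM('a)))^k"
    proof -
      have "?a k = 2 powr \<beta> * (2 powr \<beta>)^k"
        by (simp add: powr_mult powr_powr flip: powr_realpow) (simp add: mult.commute)
      moreover have "((1/2::real)^k) ^ DIM('a) = (2 powr (- real DIM('a)))^k"
        by (simp add: powr_minus powr_realpow power_one_over flip: power_mult power_inverse)
      moreover have "2 powr (\<beta> - DIM('a)) = 2 powr \<beta> * 2 powr (- real DIM('a))"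
        by (simp flip: powr_add)
      ultimately show ?thesis by (simp only: power_mult_distrib mult_ac)
    qed
    finally show "(\<integral>\<^sup>+x. ennreal (?a k) * indicator (?B k) x \<partial>lborel)
        = ennreal (2 powr \<beta> * ?c * (2 powr (\<beta> - DIM('a)))^k)" .
  qed
  also have "\<dots> = ennreal (\<Sum>k. 2 powr \<beta> * ?c * (2 powr (\<beta> - DIM('a)))^k)"
  proof (rule suminf_ennreal2)
    have "(2::real) powr (\<beta> - DIM('a)) < 1" using assms by (simp add: powr_less_one)
    thus "summable (\<lambda>k. 2 powr \<beta> * ?c * (2 powr (\<beta> - DIM('a)))^k)"
      by (intro summable_mult summable_geometric) simp
  qed simp
  also have "\<dots> < \<infinity>" by simp
  finally show "(\<integral>\<^sup>+x. ennreal (norm (indicator (ball 0 1) x * norm (x::'a) powr (-\<beta>))) \<partial>lborel) < \<infinity>" .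
qed (simp, intro borel_measurable_times borel_measurable_indicator powr_real_measurable borel_measurable_norm; simp)

lemma integrable_power_singularity:
  fixes F :: "'a::euclidean_space \<Rightarrow> 'b::{banach, second_countable_topology}" and \<beta> :: real
  assumes "0 \<le> \<beta>" "\<beta> < DIM('a)" and "F \<in> borel_measurable borel"
    and bnd: "AE x in lborel. norm x < 1 \<longrightarrow> norm (F x) \<le> C * norm x powr (-\<beta>)"
    and out: "\<And>x. 1 \<le> norm x \<Longrightarrow> F x = 0"
  shows "integrable lborel F"
proof (rule Bochner_Integration.integrable_bound)
  show "integrable lborel (\<lambda>x. C * (indicator (ball 0 1) x * norm (x::'a) powr (-\<beta>)))"
    using integrable_norm_powr_ball[OF assms(1,2)] by simp
  show "AE x in lborel. norm (F x) \<le> norm (C * (indicator (ball 0 1) x * norm x powr (-\<beta>)))"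
    using bnd
  proof eventually_elim
    case (elim x)
    show ?case
    proof (cases "norm x < 1")
      case True
      thus ?thesis using elim by simp
    qed (use out[of x] in auto)
  qed
qed (use assms(3) in simp)

lemma AE_coord_neq_0: "AE x::real^'n in lborel. x $ j \<noteq> 0"
proof -
  have "negligible {x::real^'n. x $ j = 0}" by (rule negligible_standard_hyperplane_cart)
  moreover have "{x::real^'n. x $ j = 0} \<in> sets borel" by simp
  ultimately have "{x::real^'n. x $ j = 0} \<in> null_sets lborel"
    by (simp add: negligible_iff_null_sets null_sets_completion_iff)
  thus ?thesis by (rule AE_I') auto
qed

abbreviation e\<^sub>i :: "'n::finite \<Rightarrow> real^'n" where "e\<^sub>i i \<equiv> axis i 1"

text \<open>
  The integral of a difference quotient vanishes by translation invariance. Lines in direction \<open>i\<close>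
  starting off the hyperplane \<open>x $ j = 0\<close> never meet it, so nothing is needed there.
\<close>

lemma integral_directional_derivative_bounded:
  fixes F F' :: "real^'n \<Rightarrow> real"
  assumes ij: "i \<noteq> j" and [measurable]: "F \<in> borel_measurable borel" "F' \<in> borel_measurable borel"
    and der: "\<And>x. x $ j \<noteq> 0 \<Longrightarrow> ((\<lambda>t. F (x + t *\<^sub>R e\<^sub>i i)) has_real_derivative F' x) (at 0)"
    and bnd: "\<And>x. x $ j \<noteq> 0 \<Longrightarrow> \<bar>F' x\<bar> \<le> K"
    and out: "\<And>x. 1 \<le> norm x \<Longrightarrow> F x = 0"
  shows "has_bochner_integral lborel F' 0"
proof -
  let ?e = "e\<^sub>i i :: real^'n"
  have line: "((\<lambda>t. F (x + t *\<^sub>R ?e)) has_real_derivative F' (x + t *\<^sub>R ?e)) (at t)" if "x $ j \<noteq> 0" for x t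
  proof -
    have "(x + t *\<^sub>R ?e) $ j \<noteq> 0" using that ij by (simp add: axis_def)
    from der[OF this] have "((\<lambda>s. F (x + (s + t) *\<^sub>R ?e)) has_real_derivative F' (x + t *\<^sub>R ?e)) (at 0)"
      by (simp add: algebra_simps)
    thus ?thesis using DERIV_shift[of "\<lambda>t. F (x + t *\<^sub>R ?e)" "F' (x + t *\<^sub>R ?e)" 0 t] by simp
  qed
  have lip: "\<bar>F (x + t *\<^sub>R ?e) - F x\<bar> \<le> K * \<bar>t\<bar>" if "x $ j \<noteq> 0" for x t
  proof -
    have "norm (F (x + t *\<^sub>R ?e) - F (x + 0 *\<^sub>R ?e)) \<le> K * norm (t - 0)"
      by (rule field_differentiable_bound[where S = UNIV and f' = "\<lambda>t. F' (x + t *\<^sub>R ?e)" and f = "\<lambda>t. F (x + t *\<^sub>R ?e)"])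
        (use line[OF that] bnd that ij in \<open>auto simp: axis_def\<close>)
    thus ?thesis by simp
  qed
  have K: "0 \<le> K"
  proof -
    have "\<bar>F' (e\<^sub>i j)\<bar> \<le> K" by (rule bnd) (simp add: axis_def)
    thus ?thesis by linarith
  qed
  have ne: "norm ?e = 1" by (simp add: norm_axis_1)
  \<comment> \<open>Two units along the line lead from any point of the unit ball to where
    \<open>F\<close> vanishes, so the Lipschitz bound also bounds \<open>F\<close> itself.\<close>
  have intF: "integrable lborel F"
  proof (rule integrableI_bounded_set[where A = "ball 0 1" and B = "2 * K"])
    show "AE x in lborel. x \<in> ball 0 1 \<longrightarrow> norm (F x) \<le> 2 * K"
      using AE_coord_neq_0[of j]
    proof eventually_elim
      case (elim x)
      show ?case
      proof
        assume "x \<in> ball 0 1"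
        hence "1 \<le> norm (x + 2 *\<^sub>R ?e)"
          using norm_triangle_ineq2[of "2 *\<^sub>R ?e" "- x"] ne by (simp add: add.commute)
        hence "F (x + 2 *\<^sub>R ?e) = 0" by (rule out)
        thus "norm (F x) \<le> 2 * K" using lip[OF elim, of 2] by simp
      qed
    qed
  qed (use out emeasure_lborel_ball_finite[of 0 1] in auto)
  have shift: "integrable lborel (\<lambda>x. F (x + a))" "(\<integral>x. F (x + a) \<partial>lborel) = (\<integral>x. F x \<partial>lborel)" for a
  proof -
    have [measurable]: "(+) a \<in> borel_measurable borel" by (intro borel_measurable_continuous_onI continuous_intros)
    have "integrable (distr lborel borel ((+) a)) F" "integral\<^sup>L (distr lborel borel ((+) a)) F = integral\<^sup>L lborel F"
      using intF by (simp_all add: lborel_distr_plus)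
    thus "integrable lborel (\<lambda>x. F (x + a))" "(\<integral>x. F (x + a) \<partial>lborel) = (\<integral>x. F x \<partial>lborel)"
      by (simp_all add: integrable_distr_eq integral_distr add.commute)
  qed
  define h where "h m = 1 / real (Suc m)" for m
  have h: "0 < h m" "h m \<le> 1" for m by (auto simp: h_def)
  have h0: "h \<longlonglongrightarrow> 0" unfolding h_def by (rule LIMSEQ_Suc[OF lim_1_over_n])
  define D where "D m x = (F (x + h m *\<^sub>R ?e) - F x) / h m" for m x
  have [measurable]: "D m \<in> borel_measurable borel" for m unfolding D_def by measurable
  have Dint: "integral\<^sup>L lborel (D m) = 0" for m
    unfolding D_def using shift intF by simp
  have conv: "AE x in lborel. (\<lambda>m. D m x) \<longlonglongrightarrow> F' x"
    using AE_coord_neq_0[of j]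
  proof eventually_elim
    case (elim x)
    have "((\<lambda>t. (F (x + t *\<^sub>R ?e) - F x) / t) \<longlongrightarrow> F' x) (at 0)"
      using der[OF elim] by (simp add: has_field_derivative_iff)
    moreover have "filterlim h (at 0) sequentially"
      using h0 h(1) by (auto simp: filterlim_at less_imp_neq[symmetric])
    ultimately show ?case unfolding D_def by (rule filterlim_compose)
  qed
  have dom: "AE x in lborel. norm (D m x) \<le> K * indicator (ball 0 3) x" for m
    using AE_coord_neq_0[of j]
  proof eventually_elim
    case (elim x)
    show ?case
    proof (cases "norm x < 3")
      case True
      thus ?thesis using lip[OF elim, of "h m"] h[of m] by (simp add: D_def divide_le_eq)
    next
      case False
      hence "1 \<le> norm (x + h m *\<^sub>R ?e)"
        using norm_triangle_ineq2[of x "- h m *\<^sub>R ?e"] ne h[of m] by simp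
      thus ?thesis using out False by (simp add: D_def)
    qed
  qed
  have wint: "integrable lborel (\<lambda>x. K * indicator (ball (0::real^'n) 3) x)"
    using emeasure_lborel_ball_finite[of "0::real^'n" 3] by (intro integrable_mult_right integrable_real_indicator) auto
  have "integrable lborel F'"
    by (rule integrable_dominated_convergence[OF _ _ wint conv dom]) auto
  moreover have "(\<lambda>m. integral\<^sup>L lborel (D m)) \<longlonglongrightarrow> integral\<^sup>L lborel F'"
    by (rule integral_dominated_convergence[OF _ _ wint conv dom]) auto
  hence "integral\<^sup>L lborel F' = 0" unfolding Dint by (simp add: LIMSEQ_const_iff)
  ultimately show ?thesis by (simp add: has_bochner_integral_iff)
qed

lemma norm_sq_add: "(norm (x + t *\<^sub>R e\<^sub>i i))^2 = (norm x)^2 + 2 * t * x $ i + t^2" for x :: "real^'n"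
  unfolding power2_norm_eq_inner
  by (simp add: inner_add_left inner_add_right inner_axis inner_axis' power2_eq_square algebra_simps)

lemma norm_sq_line:
  "((\<lambda>t. (norm (x + t *\<^sub>R e\<^sub>i i))^2) has_real_derivative 2 * x $ i) (at 0)" for x :: "real^'n"
  unfolding norm_sq_add by (auto intro!: derivative_eq_intros)

text \<open>The bounded case applies to \<open>F\<close> times the rational cutoff
  \<open>\<eta> k\<close>, which vanishes to second order at the origin and tends to
  \<open>1\<close> elsewhere. The term with the derivative of the cutoff tends to \<open>0\<close>
  pointwise and stays below \<open>2 * C / |x|^2\<close> uniformly in \<open>k\<close>, because
  \<open>|\<eta>' k x| * |x| \<le> 2\<close>. Dominated convergence with a multiple of
  \<open>|x|^-2\<close>, integrable near the origin in dimension at least \<open>3\<close>, finishes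
  the proof.\<close>

lemma integral_directional_derivative_singular:
  fixes F F' :: "real^'n \<Rightarrow> real"
  assumes n: "3 \<le> CARD('n)" and ij: "i \<noteq> j"
    and [measurable]: "F \<in> borel_measurable borel" "F' \<in> borel_measurable borel"
    and der: "\<And>x. x $ j \<noteq> 0 \<Longrightarrow> ((\<lambda>t. F (x + t *\<^sub>R e\<^sub>i i)) has_real_derivative F' x) (at 0)"
    and bndF: "\<And>x. x $ j \<noteq> 0 \<Longrightarrow> \<bar>F x\<bar> \<le> C / norm x"
    and bndF': "\<And>x. x $ j \<noteq> 0 \<Longrightarrow> \<bar>F' x\<bar> \<le> C / (norm x)^2"
    and out: "\<And>x. 1 \<le> norm x \<Longrightarrow> F x = 0" "\<And>x. 1 \<le> norm x \<Longrightarrow> F' x = 0"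
  shows "has_bochner_integral lborel F' 0"
proof -
  let ?e = "e\<^sub>i i :: real^'n"
  have C: "0 \<le> C"
  proof -
    have "\<bar>F (e\<^sub>i j)\<bar> \<le> C / norm (e\<^sub>i j :: real^'n)" by (rule bndF) (simp add: axis_def)
    thus ?thesis by (simp add: norm_axis_1)
  qed
  define \<eta> where "\<eta> k x = k * (norm x)^2 / (1 + k * (norm x)^2)" for k and x :: "real^'n"
  define \<eta>' where "\<eta>' k x = 2 * k * x $ i / (1 + k * (norm x)^2)^2" for k and x :: "real^'n"
  have den: "1 + k * (norm x)^2 \<noteq> 0" if "0 \<le> k" for k and x :: "real^'n"
    using that by (smt (verit) mult_nonneg_nonneg zero_le_power2)
  note nsq = norm_sq_line[of _ i]
  have \<eta>der: "((\<lambda>t. \<eta> k (x + t *\<^sub>R ?e)) has_real_derivative \<eta>' k x) (at 0)" if "0 \<le> k" for k x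
  proof -
    have gen: "((\<lambda>t. k * g t / (1 + k * g t)) has_real_derivative
        ((k * g') * (1 + k * g 0) - k * g 0 * (k * g')) / ((1 + k * g 0) * (1 + k * g 0))) (at 0)"
      if "(g has_real_derivative g') (at 0)" "1 + k * g 0 \<noteq> 0" for g g'
      using that by (auto intro!: derivative_eq_intros)
    have "((\<lambda>t. \<eta> k (x + t *\<^sub>R ?e)) has_real_derivative
        ((k * (2 * x $ i)) * (1 + k * (norm x)^2) - k * (norm x)^2 * (k * (2 * x $ i))) / ((1 + k * (norm x)^2) * (1 + k * (norm x)^2))) (at 0)"
      unfolding \<eta>_def using gen[OF nsq[of x]] den[OF that, of x] by simp
    moreover have "((k * (2 * x $ i)) * (1 + k * (norm x)^2) - k * (norm x)^2 * (k * (2 * x $ i))) / ((1 + k * (norm x)^2) * (1 + k * (norm x)^2)) = \<eta>' k x"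
      by (simp add: \<eta>'_def power2_eq_square algebra_simps)
    ultimately show ?thesis by simp
  qed
  have [measurable]: "\<eta> k \<in> borel_measurable borel" "\<eta>' k \<in> borel_measurable borel" for k
    unfolding \<eta>_def \<eta>'_def by measurable
  have ngt: "0 < norm x" if "x $ j \<noteq> 0" for x :: "real^'n" using that by auto
  have \<eta>b: "\<bar>\<eta> k x\<bar> \<le> 1" "\<bar>\<eta> k x\<bar> \<le> k * (norm x)^2" if "0 \<le> k" for k x
  proof -
    have "0 \<le> k * (norm x)^2" using that by simp
    moreover have "\<bar>a / (1 + a)\<bar> \<le> 1" "\<bar>a / (1 + a)\<bar> \<le> a" if "0 \<le> a" for a :: real
      using that by (auto simp: divide_le_eq algebra_simps)
    ultimately show "\<bar>\<eta> k x\<bar> \<le> 1" "\<bar>\<eta> k x\<bar> \<le> k * (norm x)^2" unfolding \<eta>_def by blast+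
  qed
  have \<eta>'b1: "\<bar>\<eta>' k x\<bar> \<le> 2 * k * norm x" if "0 \<le> k" for k x
  proof -
    have "\<bar>\<eta>' k x\<bar> = 2 * k * \<bar>x $ i\<bar> / (1 + k * (norm x)^2)^2" using that by (simp add: \<eta>'_def abs_mult)
    also have "\<dots> \<le> 2 * k * norm x / 1"
      using that component_le_norm_cart[of x i]
      by (intro frac_le mult_left_mono) (auto simp: power2_sum add_increasing2)
    finally show ?thesis by simp
  qed
  have \<eta>'b2: "\<bar>\<eta>' k x\<bar> * norm x \<le> 2" if "0 \<le> k" for k x
  proof -
    have "\<bar>\<eta>' k x\<bar> * norm x = 2 * k * (\<bar>x $ i\<bar> * norm x) / (1 + k * (norm x)^2)^2"
      using that by (simp add: \<eta>'_def abs_mult)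
    also have "\<dots> \<le> 2 * k * (norm x * norm x) / (1 + k * (norm x)^2)^2"
      using that component_le_norm_cart[of x i] by (intro divide_right_mono mult_left_mono mult_right_mono) auto
    also have "\<dots> \<le> 2"
    proof -
      have "2 * (k * (norm x)^2) \<le> 2 * (1 + k * (norm x)^2)^2"
        using that by (simp add: power2_sum)
      thus ?thesis using den[OF that, of x] by (simp add: divide_le_eq power2_eq_square mult_ac)
    qed
    finally show ?thesis .
  qed
  define G where "G k x = F' x * \<eta> k x + F x * \<eta>' k x" for k x
  have [measurable]: "G k \<in> borel_measurable borel" for k unfolding G_def by measurable
  have G0: "has_bochner_integral lborel (G k) 0" if k: "0 < k" for k
  proof (rule integral_directional_derivative_bounded[OF ij, where F = "\<lambda>x. F x * \<eta> k x" and K = "3 * C * k"])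
    fix x :: "real^'n" assume x: "x $ j \<noteq> 0"
    show "((\<lambda>t. F (x + t *\<^sub>R ?e) * \<eta> k (x + t *\<^sub>R ?e)) has_real_derivative G k x) (at 0)"
      using DERIV_mult[OF der[OF x] \<eta>der[of k x]] k by (simp add: G_def algebra_simps)
    have "\<bar>F' x * \<eta> k x\<bar> \<le> C / (norm x)^2 * (k * (norm x)^2)"
      unfolding abs_mult using bndF'[OF x] \<eta>b k C by (intro mult_mono) auto
    moreover have "\<bar>F x * \<eta>' k x\<bar> \<le> C / norm x * (2 * k * norm x)"
      unfolding abs_mult using bndF[OF x] \<eta>'b1 k C by (intro mult_mono) auto
    ultimately show "\<bar>G k x\<bar> \<le> 3 * C * k" using ngt[OF x] by (simp add: G_def)
  qed (use out in auto)
  have conv: "AE x in lborel. (\<lambda>m. G (real (Suc m)) x) \<longlonglongrightarrow> F' x"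
    using AE_coord_neq_0[of j]
  proof eventually_elim
    case (elim x)
    let ?a = "(norm x)^2"
    have a: "0 < ?a" using ngt[OF elim] by simp
    have kinf: "filterlim (\<lambda>m. 1 + real (Suc m) * ?a) at_top sequentially"
      using a by (intro filterlim_tendsto_add_at_top[OF tendsto_const]
          filterlim_at_top_mult_tendsto_pos[OF tendsto_const] filterlim_compose[OF filterlim_real_sequentially filterlim_Suc])
    hence inv: "(\<lambda>m. inverse (1 + real (Suc m) * ?a)) \<longlonglongrightarrow> 0" by (rule tendsto_inverse_0_at_top)
    have "(\<lambda>m. 1 - inverse (1 + real (Suc m) * ?a)) \<longlonglongrightarrow> 1 - 0" by (intro tendsto_intros inv)
    moreover have "\<eta> (real (Suc m)) x = 1 - inverse (1 + real (Suc m) * ?a)" for m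
      using den[of "real (Suc m)" x] by (simp add: \<eta>_def divide_simps)
    ultimately have 1: "(\<lambda>m. \<eta> (real (Suc m)) x) \<longlonglongrightarrow> 1" by simp
    have "(\<lambda>m. 2 * x $ i / ?a * (\<eta> (real (Suc m)) x * inverse (1 + real (Suc m) * ?a))) \<longlonglongrightarrow> 2 * x $ i / ?a * (1 * 0)"
      by (intro tendsto_intros 1 inv)
    moreover have "\<eta>' (real (Suc m)) x = 2 * x $ i / ?a * (\<eta> (real (Suc m)) x * inverse (1 + real (Suc m) * ?a))" for m
    proof -
      have *: "2 * k * y / (1 + k * b)^2 = 2 * y / b * (k * b / (1 + k * b) * inverse (1 + k * b))"
        if "b \<noteq> 0" for k y b :: real
        using that by (simp add: power2_eq_square divide_inverse)
      show ?thesis unfolding \<eta>_def \<eta>'_def by (rule *) (use a in simp)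
    qed
    ultimately have 2: "(\<lambda>m. \<eta>' (real (Suc m)) x) \<longlonglongrightarrow> 0" by simp
    have "(\<lambda>m. G (real (Suc m)) x) \<longlonglongrightarrow> F' x * 1 + F x * 0"
      unfolding G_def by (intro tendsto_intros 1 2)
    thus ?case by simp
  qed
  have dom: "AE x in lborel. norm (G (real (Suc m)) x) \<le> 3 * C * (indicator (ball 0 1) x * norm x powr (-2))" for m
    using AE_coord_neq_0[of j]
  proof eventually_elim
    case (elim x)
    show ?case
    proof (cases "norm x < 1")
      case True
      have "\<bar>F' x * \<eta> (real (Suc m)) x\<bar> \<le> C / (norm x)^2 * 1"
        unfolding abs_mult using bndF'[OF elim] \<eta>b C by (intro mult_mono) auto
      moreover have "\<bar>F x * \<eta>' (real (Suc m)) x\<bar> \<le> C / norm x * (2 / norm x)"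
        unfolding abs_mult using bndF[OF elim] \<eta>'b2[of "real (Suc m)" x] C ngt[OF elim]
        by (intro mult_mono) (auto simp: le_divide_eq)
      ultimately have "\<bar>G (real (Suc m)) x\<bar> \<le> 3 * C / (norm x)^2"
        by (simp add: G_def power2_eq_square)
      moreover have "norm x powr (-2) = 1 / (norm x)^2"
        using ngt[OF elim] by (simp add: powr_minus inverse_eq_divide)
      ultimately show ?thesis using True by simp
    qed (use out in \<open>simp add: G_def\<close>)
  qed
  have wint: "integrable lborel (\<lambda>x::real^'n. 3 * C * (indicator (ball 0 1) x * norm x powr (-2)))"
    using integrable_norm_powr_ball[of 2, where 'a = "real^'n"] n by (intro integrable_mult_right) auto
  have "integrable lborel F'"
    by (rule integrable_dominated_convergence[OF _ _ wint conv dom]) auto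
  moreover have "(\<lambda>m. integral\<^sup>L lborel (G (real (Suc m)))) \<longlonglongrightarrow> integral\<^sup>L lborel F'"
    by (rule integral_dominated_convergence[OF _ _ wint conv dom]) auto
  moreover have "integral\<^sup>L lborel (G (real (Suc m))) = 0" for m
    using G0[of "real (Suc m)"] by (simp add: has_bochner_integral_iff)
  ultimately show ?thesis by (simp add: has_bochner_integral_iff LIMSEQ_const_iff)
qed

section \<open>Test functions\<close>

definition pd :: "'n::finite \<Rightarrow> (real^'n \<Rightarrow> real) \<Rightarrow> real^'n \<Rightarrow> real" where
  "pd i h x = frechet_derivative h (at x) (e\<^sub>i i)"

lemma Basis_cart_image: "(Basis :: (real^'n) set) = e\<^sub>i ` UNIV"
  by (auto simp: Basis_vec_def)

lemma grad_nth: "grad h x $ i = pd i h x" for h :: "real^'n \<Rightarrow> real"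
proof -
  have "grad h x = (\<Sum>k\<in>UNIV. frechet_derivative h (at x) (e\<^sub>i k) *\<^sub>R (e\<^sub>i k :: real^'n))"
    unfolding grad_def Basis_cart_image by (subst sum.reindex) (auto simp: inj_on_def axis_eq_axis)
  thus ?thesis by (simp add: pd_def axis_def if_distrib cong: if_cong)
qed

lemma inner_cart: "x \<bullet> y = (\<Sum>i\<in>UNIV. x $ i * y $ i)" for x y :: "real^'n"
  by (simp add: inner_vec_def)

context
  fixes h :: "real^'n \<Rightarrow> real" and S
  assumes h: "h \<in> test_functions S"
begin

lemma test_C_k: "C_k k h" using h by (simp add: test_functions_def)

lemma test_differentiable: "h differentiable (at x)"
  using test_C_k[of 1] by simp

lemma test_continuous: "continuous_on UNIV h"
  using test_C_k[of 0] by simp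

lemma test_has_derivative: "(h has_derivative frechet_derivative h (at x)) (at x)"
  using test_differentiable frechet_derivative_works by blast

lemma test_zero: "x \<notin> S \<Longrightarrow> h x = 0"
  using h closure_subset[of "{x. h x \<noteq> 0}"] by (auto simp: test_functions_def)

lemma test_line: "((\<lambda>t. h (x + t *\<^sub>R e\<^sub>i i)) has_real_derivative pd i h x) (at 0)"
proof -
  have "((\<lambda>t. x + t *\<^sub>R e\<^sub>i i) has_derivative (\<lambda>t. t *\<^sub>R e\<^sub>i i)) (at 0)"
    by (auto intro!: derivative_eq_intros)
  moreover have "(h has_derivative frechet_derivative h (at x)) (at (x + 0 *\<^sub>R e\<^sub>i i))"
    using test_has_derivative by simp
  ultimately have "((\<lambda>t. h (x + t *\<^sub>R e\<^sub>i i)) has_derivative (\<lambda>t. frechet_derivative h (at x) (t *\<^sub>R e\<^sub>i i))) (at 0)"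
    by (rule has_derivative_compose)
  moreover have "(\<lambda>t. frechet_derivative h (at x) (t *\<^sub>R e\<^sub>i i)) = (*) (pd i h x)"
    using linear_scale[OF linear_frechet_derivative[OF test_differentiable]] by (auto simp: pd_def)
  ultimately show ?thesis by (simp only: has_field_derivative_def)
qed

lemma pd_zero: assumes "x \<notin> closure {x. h x \<noteq> 0}" shows "pd i h x = 0"
proof -
  have "(h has_derivative (\<lambda>_. 0)) (at x)"
  proof (rule has_derivative_transform_within_open)
    show "((\<lambda>_. 0) has_derivative (\<lambda>_. 0)) (at x)" by simp
    show "open (- closure {x. h x \<noteq> 0})" by (intro open_Compl closed_closure)
    show "x \<in> - closure {x. h x \<noteq> 0}" using assms by simp
    show "0 = h y" if "y \<in> - closure {x. h x \<noteq> 0}" for y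
      using that closure_subset[of "{x. h x \<noteq> 0}"] by auto
  qed
  thus ?thesis unfolding pd_def using frechet_derivative_at by metis
qed

text \<open>Allows integration by parts against derivatives of test functions, as the potential of
  the drift requires.\<close>

lemma pd_test: "pd i h \<in> test_functions S"
proof -
  have "C_k k (pd i h)" for k
    using test_C_k[of "Suc k"] by (simp add: pd_def[abs_def])
  moreover have "{x. pd i h x \<noteq> 0} \<subseteq> closure {x. h x \<noteq> 0}" using pd_zero by blast
  hence sub: "closure {x. pd i h x \<noteq> 0} \<subseteq> closure {x. h x \<noteq> 0}" by (simp add: closure_minimal)
  moreover have "compact (closure {x. pd i h x \<noteq> 0})"
    using h bounded_subset[OF _ sub] by (auto simp: test_functions_def compact_eq_bounded_closed)
  ultimately show ?thesis using h by (auto simp: test_functions_def)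
qed

lemma test_bounded: "\<exists>B>0. \<forall>x. \<bar>h x\<bar> \<le> B"
proof -
  have "compact (h ` closure {x. h x \<noteq> 0})"
    using h test_continuous
    by (intro compact_continuous_image continuous_on_subset[OF test_continuous]) (auto simp: test_functions_def)
  then obtain B where B: "\<And>x. x \<in> closure {x. h x \<noteq> 0} \<Longrightarrow> \<bar>h x\<bar> \<le> B"
    by (fastforce dest: compact_imp_bounded simp: bounded_iff)
  have "\<bar>h x\<bar> \<le> max B 1" for x
    using B[of x] closure_subset[of "{x. h x \<noteq> 0}"] by (cases "h x = 0") (auto simp: le_max_iff_disj)
  thus ?thesis by (intro exI[of _ "max B 1"]) auto
qed

lemma test_measurable: "h \<in> borel_measurable borel"
  by (rule borel_measurable_continuous_onI[OF test_continuous])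

end

text \<open>Two applications of the mean value theorem, in direction \<open>i\<close> and then in
  direction \<open>j\<close>. The left-hand side is symmetric in the two directions and the
  right-hand side is not; small \<open>s\<close> in both orders yields the symmetry of mixed
  derivatives.\<close>

lemma second_difference:
  assumes h: "h \<in> test_functions S" and s: "0 < s"
  shows "\<exists>a b. 0 \<le> a \<and> a \<le> s \<and> 0 \<le> b \<and> b \<le> s \<and>
    h (x + s *\<^sub>R e\<^sub>i i + s *\<^sub>R e\<^sub>i j) - h (x + s *\<^sub>R e\<^sub>i i) - h (x + s *\<^sub>R e\<^sub>i j) + h x
      = s^2 * pd j (pd i h) (x + a *\<^sub>R e\<^sub>i i + b *\<^sub>R e\<^sub>i j)"
proof -
  have line: "((\<lambda>t. f (y + t *\<^sub>R e\<^sub>i k)) has_real_derivative pd k f (y + t *\<^sub>R e\<^sub>i k)) (at t)"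
    if f: "f \<in> test_functions S" for f y k t
  proof -
    have "((\<lambda>u. f (y + (u + t) *\<^sub>R e\<^sub>i k)) has_real_derivative pd k f (y + t *\<^sub>R e\<^sub>i k)) (at 0)"
      using test_line[OF f, of "y + t *\<^sub>R e\<^sub>i k" k] by (simp add: algebra_simps)
    thus ?thesis using DERIV_shift[of "\<lambda>t. f (y + t *\<^sub>R e\<^sub>i k)" "pd k f (y + t *\<^sub>R e\<^sub>i k)" 0 t] by simp
  qed
  let ?g = "\<lambda>t. h ((x + s *\<^sub>R e\<^sub>i j) + t *\<^sub>R e\<^sub>i i) - h (x + t *\<^sub>R e\<^sub>i i)"
  have "(?g has_real_derivative pd i h ((x + s *\<^sub>R e\<^sub>i j) + t *\<^sub>R e\<^sub>i i) - pd i h (x + t *\<^sub>R e\<^sub>i i)) (at t)" for t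
    by (intro DERIV_diff line h)
  from MVT2[OF s this] obtain a where a: "0 < a" "a < s"
    "?g s - ?g 0 = s * (pd i h ((x + s *\<^sub>R e\<^sub>i j) + a *\<^sub>R e\<^sub>i i) - pd i h (x + a *\<^sub>R e\<^sub>i i))" by auto
  let ?k = "\<lambda>t. pd i h ((x + a *\<^sub>R e\<^sub>i i) + t *\<^sub>R e\<^sub>i j)"
  have "(?k has_real_derivative pd j (pd i h) ((x + a *\<^sub>R e\<^sub>i i) + t *\<^sub>R e\<^sub>i j)) (at t)" for t
    by (intro line pd_test h)
  from MVT2[OF s this] obtain b where b: "0 < b" "b < s"
    "?k s - ?k 0 = s * pd j (pd i h) ((x + a *\<^sub>R e\<^sub>i i) + b *\<^sub>R e\<^sub>i j)" by auto
  have "?g s - ?g 0 = s * (?k s - ?k 0)" using a(3) by (simp add: add_ac)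
  hence "?g s - ?g 0 = s^2 * pd j (pd i h) (x + a *\<^sub>R e\<^sub>i i + b *\<^sub>R e\<^sub>i j)"
    unfolding b(3) by (simp add: power2_eq_square)
  thus ?thesis using a b by (intro exI[of _ a] exI[of _ b]) (auto simp: algebra_simps)
qed

lemma pd_commute:
  assumes h: "h \<in> test_functions S"
  shows "pd i (pd j h) x = pd j (pd i h) x"
proof -
  define s where "s n = 1 / real (Suc n)" for n
  have s: "0 < s n" for n by (simp add: s_def)
  have s0: "s \<longlonglongrightarrow> 0" unfolding s_def by (rule LIMSEQ_Suc[OF lim_1_over_n])
  define Q where "Q n = (h (x + s n *\<^sub>R e\<^sub>i i + s n *\<^sub>R e\<^sub>i j) - h (x + s n *\<^sub>R e\<^sub>i i) - h (x + s n *\<^sub>R e\<^sub>i j) + h x) / (s n)^2" for n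
  have lim: "Q \<longlonglongrightarrow> pd q (pd p h) x" if pq: "p = i \<and> q = j \<or> p = j \<and> q = i" for p q
  proof -
    have "\<exists>a b. 0 \<le> a \<and> a \<le> s n \<and> 0 \<le> b \<and> b \<le> s n \<and> Q n = pd q (pd p h) (x + a *\<^sub>R e\<^sub>i p + b *\<^sub>R e\<^sub>i q)" for n
    proof -
      obtain a b where ab: "0 \<le> a" "a \<le> s n" "0 \<le> b" "b \<le> s n"
        and eq: "h (x + s n *\<^sub>R e\<^sub>i p + s n *\<^sub>R e\<^sub>i q) - h (x + s n *\<^sub>R e\<^sub>i p) - h (x + s n *\<^sub>R e\<^sub>i q) + h x
          = (s n)^2 * pd q (pd p h) (x + a *\<^sub>R e\<^sub>i p + b *\<^sub>R e\<^sub>i q)"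
        using second_difference[OF h s[of n], of x p q] by blast
      have "Q n = (h (x + s n *\<^sub>R e\<^sub>i p + s n *\<^sub>R e\<^sub>i q) - h (x + s n *\<^sub>R e\<^sub>i p) - h (x + s n *\<^sub>R e\<^sub>i q) + h x) / (s n)^2"
        using pq by (auto simp: Q_def algebra_simps)
      also have "\<dots> = pd q (pd p h) (x + a *\<^sub>R e\<^sub>i p + b *\<^sub>R e\<^sub>i q)"
        unfolding eq using s[of n] by simp
      finally show ?thesis using ab by blast
    qed
    then obtain a b where ab: "\<And>n. 0 \<le> a n" "\<And>n. a n \<le> s n" "\<And>n. 0 \<le> b n" "\<And>n. b n \<le> s n"
      and Q: "\<And>n. Q n = pd q (pd p h) (x + a n *\<^sub>R e\<^sub>i p + b n *\<^sub>R e\<^sub>i q)" by metis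
    have "a \<longlonglongrightarrow> 0" "b \<longlonglongrightarrow> 0"
      using ab by (auto intro!: tendsto_sandwich[OF _ _ tendsto_const s0])
    hence "(\<lambda>n. x + a n *\<^sub>R e\<^sub>i p + b n *\<^sub>R e\<^sub>i q) \<longlonglongrightarrow> x + 0 *\<^sub>R e\<^sub>i p + 0 *\<^sub>R e\<^sub>i q"
      by (intro tendsto_intros)
    moreover have "isCont (pd q (pd p h)) x"
      using test_continuous[OF pd_test[OF pd_test[OF h]]] by (simp add: continuous_on_eq_continuous_at)
    ultimately show ?thesis unfolding Q[abs_def] using isCont_tendsto_compose by fastforce
  qed
  show ?thesis using LIMSEQ_unique[OF lim[of j i] lim[of i j]] by simp
qed

text \<open>The singular case applied to the product of \<open>G\<close> and \<open>h\<close>; where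
  \<open>h\<close> vanishes, no bound on \<open>G\<close> is required. The index \<open>j\<close>
  names a null hyperplane, parallel to direction \<open>i\<close>, that contains the singular set of
  \<open>G\<close>.\<close>

lemma integration_by_parts_test:
  fixes G G' :: "real^'n \<Rightarrow> real"
  assumes n: "3 \<le> CARD('n)" and ij: "i \<noteq> j" and h: "h \<in> test_functions (ball 0 (1/2))"
    and [measurable]: "G \<in> borel_measurable borel" "G' \<in> borel_measurable borel"
    and der: "\<And>x. x $ j \<noteq> 0 \<Longrightarrow> ((\<lambda>t. G (x + t *\<^sub>R e\<^sub>i i)) has_real_derivative G' x) (at 0)"
    and bnd: "\<And>x. x $ j \<noteq> 0 \<Longrightarrow> norm x < 1/2 \<Longrightarrow> \<bar>G x\<bar> \<le> C / norm x"
      "\<And>x. x $ j \<noteq> 0 \<Longrightarrow> norm x < 1/2 \<Longrightarrow> \<bar>G' x\<bar> \<le> C / (norm x)^2"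
  shows "has_bochner_integral lborel (\<lambda>x. G' x * h x + G x * pd i h x) 0"
proof -
  obtain B1 where B1: "0 < B1" "\<And>x. \<bar>h x\<bar> \<le> B1" using test_bounded[OF h] by blast
  obtain B2 where B2: "0 < B2" "\<And>x. \<bar>pd i h x\<bar> \<le> B2" using test_bounded[OF pd_test[OF h]] by blast
  have C: "0 \<le> C"
  proof -
    have "\<bar>G ((1/4) *\<^sub>R e\<^sub>i j)\<bar> \<le> C / norm ((1/4) *\<^sub>R e\<^sub>i j :: real^'n)"
      by (rule bnd) (simp_all add: axis_def norm_axis_1[unfolded axis_def])
    thus ?thesis by (simp add: norm_axis_1)
  qed
  have z: "h x = 0" "pd i h x = 0" if "1/2 \<le> norm x" for x
    using test_zero[OF h] test_zero[OF pd_test[OF h]] that by auto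
  note [measurable] = test_measurable[OF h] test_measurable[OF pd_test[OF h]]
  show ?thesis
  proof (rule integral_directional_derivative_singular[OF n ij, where F = "\<lambda>x. G x * h x" and C = "C * (B1 + B2)"])
    fix x :: "real^'n" assume x: "x $ j \<noteq> 0"
    have nx: "0 < norm x" using x by auto
    show "((\<lambda>t. G (x + t *\<^sub>R e\<^sub>i i) * h (x + t *\<^sub>R e\<^sub>i i)) has_real_derivative G' x * h x + G x * pd i h x) (at 0)"
      using DERIV_mult[OF der[OF x] test_line[OF h, of x i]] by (simp add: algebra_simps)
    show "\<bar>G x * h x\<bar> \<le> C * (B1 + B2) / norm x"
    proof (cases "norm x < 1/2")
      case True
      have "\<bar>G x * h x\<bar> \<le> C / norm x * (B1 + B2)"
        unfolding abs_mult using bnd(1)[OF x True] B1 B2 C by (intro mult_mono) (auto intro: add_increasing2)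
      thus ?thesis by simp
    qed (use z B1 B2 C in auto)
    show "\<bar>G' x * h x + G x * pd i h x\<bar> \<le> C * (B1 + B2) / (norm x)^2"
    proof (cases "norm x < 1/2")
      case True
      have "\<bar>G' x * h x\<bar> \<le> C / (norm x)^2 * B1"
        unfolding abs_mult using bnd(2)[OF x True] B1 C by (intro mult_mono) auto
      moreover have "\<bar>G x * pd i h x\<bar> \<le> C / norm x * B2"
        unfolding abs_mult using bnd(1)[OF x True] B2 C by (intro mult_mono) auto
      moreover have "C / norm x * B2 \<le> C / (norm x)^2 * B2"
        using True nx C B2 by (intro mult_right_mono divide_left_mono) (auto simp: power2_eq_square mult_le_one intro: mult_left_le)
      ultimately show ?thesis by (simp add: algebra_simps add_divide_distrib)
    qed (use z B1 B2 C in auto)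
  qed (use z in auto)
qed

text \<open>Bridge from Borel integrals over the whole space, where translation invariance was used,
  to the completed measure on the ball in which the notions are phrased.\<close>

lemma has_bochner_integral_lebesgue_on_ball:
  fixes f :: "'a::euclidean_space \<Rightarrow> 'b::{banach, second_countable_topology}"
  assumes "has_bochner_integral lborel (\<lambda>x. indicator (ball 0 r) x *\<^sub>R f x) I"
  shows "has_bochner_integral (lebesgue_on (ball 0 r)) f I"
proof -
  have meas: "(\<lambda>x. indicator (ball 0 r) x *\<^sub>R f x) \<in> borel_measurable lborel"
    using assms by (auto simp: has_bochner_integral_iff)
  hence "has_bochner_integral lebesgue (\<lambda>x. indicator (ball 0 r) x *\<^sub>R f x) I"
    using assms integrable_completion[OF meas] integral_completion[OF meas]
    unfolding has_bochner_integral_iff by simp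
  thus ?thesis by (subst Lebesgue_Measure.has_bochner_integral_restrict_space) auto
qed

lemma has_bochner_integral_lebesgue_on_ball_support:
  fixes f :: "'a::euclidean_space \<Rightarrow> 'b::{banach, second_countable_topology}"
  assumes f: "has_bochner_integral lborel f I" and z: "\<And>x. x \<notin> ball 0 r \<Longrightarrow> f x = 0"
  shows "has_bochner_integral (lebesgue_on (ball 0 r)) f I"
proof -
  have "(\<lambda>x. indicator (ball 0 r) x *\<^sub>R f x) = f" using z by (auto simp: indicator_def fun_eq_iff)
  thus ?thesis using f by (intro has_bochner_integral_lebesgue_on_ball) simp
qed

section \<open>The radial profile\<close>

lemma abs_add3:
  fixes a b c :: real
  shows "\<bar>a\<bar> \<le> A \<Longrightarrow> \<bar>b\<bar> \<le> B \<Longrightarrow> \<bar>c\<bar> \<le> C \<Longrightarrow> \<bar>a + b + c\<bar> \<le> A + B + C"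
  by linarith

text \<open>The parameter \<open>\<nu>\<close> will be the dimension. The bound
  \<open>d \<le> 1/2\<close> means \<open>1/d \<ge> 2\<close>, which flattens
  \<open>M \<circ> rs 0\<close> at the critical level \<open>1\<close>.\<close>

locale profile =
  fixes d \<nu> :: real
  assumes d_pos: "0 < d" and d_le: "d \<le> 1/2" and nu_ge: "3 \<le> \<nu>"
begin

text \<open>With \<open>X = R^d\<close>, the negative of the fraction's numerator is
  \<open>R^3 / z\<close> times the Laplacian of \<open>u\<close>; see
  \<open>laplace_eq\<close>.\<close>

definition m :: "real \<Rightarrow> real" where
  "m X = - ((\<nu> - 1) + (1 - d) * (\<nu> - 1 + d) * X) / (1 + X)^2"

definition M :: "real \<Rightarrow> real" where
  "M R = integral {0..R} (\<lambda>r. m (r powr d))"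

text \<open>
  On the axis, where \<open>R^2 = z^2 + q\<close>, one has \<open>u^2 = H q R\<close>. Accordingly \<open>rs q v\<close> is the radius at
  which the level set \<open>u^2 = v\<close> meets the axis; it is \<open>0\<close> when they do not meet, that is for \<open>q = 0\<close>
  and \<open>v \<le> 1\<close>. In that case the formula for \<open>L\<close> below, the derivative of \<open>M \<circ> rs q\<close>, correctly
  yields \<open>0\<close>.
\<close>

definition H :: "real \<Rightarrow> real \<Rightarrow> real" where
  "H q R = (1 + R powr d)^2 * (1 - q / R^2)"

text \<open>Up to the factor \<open>2 * (1 + R powr d) / R\<close> this is the derivative of
  \<open>H q\<close>, see \<open>H_deriv\<close>. Its lower bound \<open>d * R powr d\<close> for
  \<open>q \<ge> 0\<close> degenerates at the origin and is the source of the loss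
  \<open>R^(-d)\<close> in the drift.\<close>

definition E :: "real \<Rightarrow> real \<Rightarrow> real" where
  "E q R = d * R powr d + (1 + (1 - d) * R powr d) * (q / R^2)"

definition rs :: "real \<Rightarrow> real \<Rightarrow> real" where
  "rs q v = Inf {r. 0 < r \<and> v < H q r}"

definition L :: "real \<Rightarrow> real \<Rightarrow> real" where
  "L q v = m (rs q v powr d) * rs q v / (2 * (1 + rs q v powr d) * E q (rs q v))"

lemma coeff_bounds: "0 \<le> (1 - d) * (\<nu> - 1 + d)" "(1 - d) * (\<nu> - 1 + d) \<le> \<nu>"
  "\<bar>(\<nu> - 1) - (1 - d) * (\<nu> - 1 + d)\<bar> \<le> \<nu>"
proof -
  show "0 \<le> (1 - d) * (\<nu> - 1 + d)" using d_pos d_le nu_ge by simp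
  have *: "(\<nu> - 1) - (1 - d) * (\<nu> - 1 + d) = d * (\<nu> - 2 + d)"
    by (simp add: algebra_simps)
  have "0 \<le> d * (\<nu> - 2 + d)" using d_pos nu_ge by simp
  moreover have "d * (\<nu> - 2 + d) \<le> 1 * (\<nu> - 2 + d)"
    using d_pos d_le nu_ge by (intro mult_right_mono) auto
  ultimately show "\<bar>(\<nu> - 1) - (1 - d) * (\<nu> - 1 + d)\<bar> \<le> \<nu>"
    "(1 - d) * (\<nu> - 1 + d) \<le> \<nu>"
    unfolding atomize_conj * using d_le nu_ge *
    by (auto simp: abs_le_iff)
qed

lemma m_bound: assumes "0 \<le> X" shows "\<bar>m X\<bar> \<le> \<nu>"
proof -
  have "(1 - d) * (\<nu> - 1 + d) * X \<le> \<nu> * X"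
    using coeff_bounds assms by (intro mult_right_mono) auto
  hence "(\<nu> - 1) + (1 - d) * (\<nu> - 1 + d) * X \<le> \<nu> * (1 + X)"
    by (simp add: algebra_simps)
  also have "\<dots> \<le> \<nu> * (1 + X)^2"
    using assms nu_ge by (intro mult_left_mono) (auto simp: power2_eq_square algebra_simps)
  finally have "(\<nu> - 1) + (1 - d) * (\<nu> - 1 + d) * X \<le> \<nu> * (1 + X)^2" .
  moreover have "0 \<le> (\<nu> - 1) + (1 - d) * (\<nu> - 1 + d) * X"
    using coeff_bounds assms nu_ge by simp
  moreover have "0 < (1 + X)^2" using assms by simp
  ultimately show ?thesis
    unfolding m_def abs_divide abs_minus_cancel by (simp add: divide_le_eq)
qed

lemma m_integrand_continuous: "continuous_on {0..} (\<lambda>r. m (r powr d))"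
proof -
  have "1 + r powr d \<noteq> 0" for r
    by (smt (verit) powr_ge_zero)
  thus ?thesis
    unfolding m_def using d_pos by (intro continuous_intros continuous_on_powr') auto
qed

lemma M_deriv: assumes "0 < R" shows "(M has_real_derivative m (R powr d)) (at R)"
proof -
  have "(M has_real_derivative m (R powr d)) (at R within {0..R+1})"
    unfolding M_def using assms
    by (intro integral_has_real_derivative continuous_on_subset[OF m_integrand_continuous]) auto
  moreover have "at R within {0..R+1} = at R"
    using assms by (intro at_within_interior) auto
  ultimately show ?thesis by simp
qed

lemma M_nonpos: "R \<le> 0 \<Longrightarrow> M R = 0"
  by (cases "R = 0") (auto simp: M_def)

lemma M_Lipschitz: assumes "0 \<le> a" "0 \<le> b" shows "\<bar>M a - M b\<bar> \<le> \<nu> * \<bar>a - b\<bar>"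
proof -
  have *: "\<bar>M b - M a\<bar> \<le> \<nu> * (b - a)" if "0 \<le> a" "a \<le> b" for a b
  proof -
    have i: "(\<lambda>r. m (r powr d)) integrable_on {0..b}"
      by (intro integrable_continuous_interval continuous_on_subset[OF m_integrand_continuous]) auto
    have "M b - M a = integral {a..b} (\<lambda>r. m (r powr d))"
      unfolding M_def using Henstock_Kurzweil_Integration.integral_combine[OF that i] by linarith
    also have "norm \<dots> \<le> \<nu> * (b - a)"
      using that m_bound
      by (intro integral_bound continuous_on_subset[OF m_integrand_continuous]) auto
    finally show ?thesis by simp
  qed
  show ?thesis using *[of a b] *[of b a] assms by (cases "a \<le> b") (auto simp: abs_minus_commute)
qed

lemma M_measurable [measurable]: "M \<in> borel_measurable borel"
proof -
  have "continuous_on {0..} M"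
  proof (rule continuous_on_iff[THEN iffD2], intro ballI allI impI)
    fix x e :: real assume x: "x \<in> {0..}" and e: "0 < e"
    show "\<exists>\<delta>>0. \<forall>x'\<in>{0..}. dist x' x < \<delta> \<longrightarrow> dist (M x') (M x) < e"
    proof (intro exI[of _ "e / \<nu>"] conjI ballI impI)
      show "0 < e / \<nu>" using e nu_ge by simp
      fix y assume "y \<in> {0..}" "dist y x < e / \<nu>"
      hence "\<nu> * \<bar>y - x\<bar> < e" using nu_ge by (simp add: dist_real_def field_simps)
      thus "dist (M y) (M x) < e"
        using M_Lipschitz[of y x] x \<open>y \<in> {0..}\<close> by (simp add: dist_real_def)
    qed
  qed
  hence "continuous_on UNIV (\<lambda>R. M (max 0 R))"
    by (rule continuous_on_compose2) (auto intro!: continuous_intros)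
  moreover have "(\<lambda>R. M (max 0 R)) = M"
    by (rule ext) (auto simp: max_def M_nonpos)
  ultimately show ?thesis by (metis borel_measurable_continuous_onI)
qed

section \<open>Monotonicity of \<open>H q\<close> and its generalised inverse
  \<open>rs q\<close>\<close>

lemma powr_deriv: "0 < R \<Longrightarrow> ((\<lambda>R. R powr d) has_real_derivative d * R powr d / R) (at R)"
  by (auto intro!: derivative_eq_intros simp: powr_diff)

lemma E_pos: assumes "0 < R" "0 \<le> q" shows "d * R powr d \<le> E q R" "0 < E q R"
proof -
  have "0 \<le> (1 + (1 - d) * R powr d) * (q / R^2)"
    using assms d_le by (intro mult_nonneg_nonneg) auto
  thus "d * R powr d \<le> E q R" by (simp add: E_def)
  moreover have "0 < d * R powr d" using d_pos assms by simp
  ultimately show "0 < E q R" by linarith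
qed

lemma H_deriv: assumes "0 < R"
  shows "(H q has_real_derivative 2 * (1 + R powr d) * E q R / R) (at R)"
proof -
  have a: "((\<lambda>R. 1 + R powr d) has_real_derivative d * R powr d / R) (at R)"
    using DERIV_add[OF DERIV_const powr_deriv[OF assms], of 1] by simp
  have b: "((\<lambda>R. 1 - q / R^2) has_real_derivative 2 * q / R^3) (at R)"
    using assms by (auto intro!: derivative_eq_intros simp: field_simps power3_eq_cube power2_eq_square)
  have "(H q has_real_derivative
      2 * (1 + R powr d) * (d * R powr d / R) * (1 - q / R^2) + (1 + R powr d)^2 * (2 * q / R^3)) (at R)"
    unfolding H_def using DERIV_mult[OF DERIV_power[OF a, of 2] b]
    by (rule DERIV_cong) (simp add: algebra_simps add_divide_distrib diff_divide_distrib)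
  also have "2 * (1 + R powr d) * (d * R powr d / R) * (1 - q / R^2) + (1 + R powr d)^2 * (2 * q / R^3)
      = 2 * (1 + R powr d) * E q R / R"
    using assms by (simp add: E_def field_simps power3_eq_cube power2_eq_square)
  finally show ?thesis .
qed

lemma H_strict_mono: assumes "0 \<le> q" "0 < a" "a < b" shows "H q a < H q b"
proof (rule DERIV_pos_imp_increasing[OF assms(3)])
  fix x assume "a \<le> x" "x \<le> b"
  hence x: "0 < x" using assms by linarith
  have "0 < 2 * (1 + x powr d) * E q x / x"
    using E_pos[OF x assms(1)] x by (intro divide_pos_pos mult_pos_pos) (auto intro: add_pos_nonneg)
  thus "\<exists>y. (H q has_real_derivative y) (at x) \<and> 0 < y" using H_deriv[OF x] by blast
qed

lemma H_isCont: "0 < R \<Longrightarrow> isCont (H q) R"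
  using H_deriv DERIV_isCont by blast

lemma H_unbounded: assumes "0 \<le> q" shows "\<exists>r>0. v < H q r"
proof -
  \<comment> \<open>The first entry of the maximum gives \<open>q / r^2 \<le> 1/2\<close>, the
    second \<open>r powr d \<ge> 2 * |v| + 1\<close>, so that \<open>H q r\<close> exceeds
    \<open>|v|\<close>.\<close>
  define r where "r = max (sqrt (2 * q) + 1) ((2 * \<bar>v\<bar> + 1) powr (1/d))"
  have "2 * q \<le> (sqrt (2 * q) + 1)^2" using assms by (simp add: power2_sum)
  also have "\<dots> \<le> r^2" unfolding r_def using assms by (intro power_mono) auto
  finally have q: "2 * q \<le> r^2" .
  have r: "0 < r" unfolding r_def using assms
    by (intro less_max_iff_disj[THEN iffD2] disjI1) (auto intro: add_nonneg_pos)
  have h: "1/2 \<le> 1 - q / r^2" using q r by (simp add: field_simps)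
  have "((2 * \<bar>v\<bar> + 1) powr (1/d)) powr d \<le> r powr d"
    unfolding r_def using d_pos by (intro powr_mono2) auto
  hence X: "2 * \<bar>v\<bar> + 1 \<le> r powr d" using d_pos by (simp add: powr_powr)
  have "2 * \<bar>v\<bar> + 1 \<le> (1 + r powr d)^2"
    using X by (simp add: power2_sum) (smt (verit) zero_le_power2)
  hence "(2 * \<bar>v\<bar> + 1) * (1/2) \<le> (1 + r powr d)^2 * (1 - q / r^2)"
    using h by (intro mult_mono) auto
  hence "(2 * \<bar>v\<bar> + 1) * (1/2) \<le> H q r" unfolding H_def .
  moreover have "v < (2 * \<bar>v\<bar> + 1) * (1/2)" by (simp add: abs_if)
  ultimately have "v < H q r" by (rule less_le_trans[rotated])
  thus ?thesis using r by blast
qed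

lemma rs_set: "{r. 0 < r \<and> v < H q r} \<noteq> {}" if "0 \<le> q"
  using H_unbounded[OF that] by blast

lemma rs_nonneg: "0 \<le> q \<Longrightarrow> 0 \<le> rs q v"
  unfolding rs_def by (intro cInf_greatest rs_set) auto

text \<open>Continuity and strict monotonicity of \<open>H q\<close> turn the infimum into this
  equivalence, from which continuity, measurability and the zeros of \<open>rs\<close> are read
  off.\<close>

lemma rs_less_iff: assumes "0 \<le> q" "0 < r" shows "rs q v < r \<longleftrightarrow> v < H q r"
proof
  assume "rs q v < r"
  then obtain r' where r': "0 < r'" "v < H q r'" "r' < r"
    unfolding rs_def using cInf_lessD[OF rs_set[OF assms(1)]] by blast
  thus "v < H q r" using H_strict_mono[of q r' r] assms by linarith
next
  assume v: "v < H q r"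
  have "eventually (\<lambda>x. v < H q x) (at_left r)"
    using H_isCont[OF assms(2)] v
    by (metis continuous_within filterlim_at_split isCont_def order_tendstoD(1))
  then obtain b where b: "b < r" "\<And>y. b < y \<Longrightarrow> y < r \<Longrightarrow> v < H q y"
    unfolding eventually_at_left_field by blast
  define r' where "r' = max ((b + r) / 2) (r / 2)"
  have "0 < r'" "r' < r" "b < r'" using b(1) assms(2) by (auto simp: r'_def max_def)
  hence "rs q v \<le> r'" unfolding rs_def using b(2)
    by (intro cInf_lower) (auto intro!: bdd_belowI[of _ 0])
  thus "rs q v < r" using \<open>r' < r\<close> by linarith
qed

lemma H_rs: assumes "0 \<le> q" "0 < rs q v" shows "H q (rs q v) = v"
proof (rule antisym)
  show "H q (rs q v) \<le> v" using rs_less_iff[OF assms] by fastforce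
  show "v \<le> H q (rs q v)"
  proof (rule tendsto_lowerbound)
    show "(H q \<longlongrightarrow> H q (rs q v)) (at_right (rs q v))"
      using H_isCont[OF assms(2)] by (simp add: isCont_def filterlim_at_split)
    show "\<forall>\<^sub>F x in at_right (rs q v). v \<le> H q x"
      unfolding eventually_at_right_field
      using rs_less_iff[OF assms(1)] assms(2)
      by (intro exI[of _ "rs q v + 1"]) (metis less_add_one less_imp_le order.strict_trans)
  qed simp
qed

lemma rs_pos: assumes "0 < q" shows "0 < rs q v"
proof -
  \<comment> \<open>Chosen so that \<open>1 - q / r^2 = - |v|\<close>; then
    \<open>H q r \<le> v\<close>, and the infimum cannot lie below \<open>r\<close>.\<close>
  define r where "r = sqrt (q / (1 + \<bar>v\<bar>))"
  have r: "0 < r" and r2: "r^2 = q / (1 + \<bar>v\<bar>)" using assms by (auto simp: r_def)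
  have "H q r = (1 + r powr d)^2 * (- \<bar>v\<bar>)"
    unfolding H_def r2 using assms by simp
  also have "\<dots> \<le> 1 * (- \<bar>v\<bar>)"
    by (intro mult_right_mono_neg) (auto simp: power2_sum add_increasing2)
  finally have "\<not> v < H q r" by linarith
  hence "\<not> rs q v < r" using rs_less_iff[of q r] assms r by simp
  thus ?thesis using r by linarith
qed

text \<open>The function \<open>H 0 r = (1 + r^d)^2\<close> decreases to \<open>1\<close> as
  \<open>r\<close> tends to \<open>0\<close> without reaching it, so exactly the levels up to
  \<open>1\<close> miss the axis.\<close>

lemma rs_0_eq_0_iff: "rs 0 v = 0 \<longleftrightarrow> v \<le> 1"
proof
  assume "rs 0 v = 0"
  hence "v < H 0 r" if "0 < r" for r using rs_less_iff[of 0 r v] that by simp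
  hence "\<forall>\<^sub>F r in at_right 0. v \<le> (1 + r powr d)^2"
    unfolding eventually_at_right_field H_def
    by (intro exI[of _ 1]) (auto intro: less_imp_le)
  moreover have "((\<lambda>r. (1 + r powr d)^2) \<longlongrightarrow> (1 + 0 powr d)^2) (at_right 0)"
    using d_pos by (intro tendsto_intros tendsto_powr2) (auto simp: eventually_at_right_less eventually_at_filter)
  ultimately have "v \<le> (1 + 0 powr d)^2"
    by (intro tendsto_lowerbound[where F = "at_right 0"]) auto
  thus "v \<le> 1" using d_pos by simp
next
  assume v: "v \<le> 1"
  have "rs 0 v < r" if "0 < r" for r
  proof -
    have "0 < r powr d" using that by simp
    hence "1 < (1 + r powr d)^2" by (simp add: power2_sum add_pos_pos)
    hence "v < H 0 r" using v by (simp add: H_def)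
    thus ?thesis using rs_less_iff[of 0 r v] that by simp
  qed
  thus "rs 0 v = 0" using rs_nonneg[of 0 v] by (metis less_le order.irrefl order.refl)
qed

lemma rs_eq_0_iff: assumes "0 \<le> q" shows "rs q v = 0 \<longleftrightarrow> q = 0 \<and> v \<le> 1"
  using assms rs_pos[of q v] rs_0_eq_0_iff[of v] by (cases "q = 0") auto

lemma rs_isCont: assumes "0 \<le> q" "0 < rs q v" shows "isCont (rs q) v"
  unfolding isCont_def
proof (rule order_tendstoI)
  fix a assume a: "a < rs q v"
  show "\<forall>\<^sub>F y in at v. a < rs q y"
  proof (cases "0 < a")
    case True
    define c where "c = (a + rs q v) / 2"
    have c: "a < c" "c < rs q v" using a by (auto simp: c_def)
    have "H q c < v" using H_strict_mono[OF assms(1) _ c(2)] H_rs[OF assms] True c by simp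
    hence "\<forall>\<^sub>F y in at v. H q c < y" by (intro order_tendstoD(1)[OF tendsto_ident_at])
    thus ?thesis
      by eventually_elim (use rs_less_iff[OF assms(1), of c] True c in \<open>smt (verit)\<close>)
  next
    case False
    have "H q (rs q v / 2) < v"
      using H_strict_mono[OF assms(1), of "rs q v / 2" "rs q v"] H_rs[OF assms] assms(2) by simp
    hence "\<forall>\<^sub>F y in at v. H q (rs q v / 2) < y" by (intro order_tendstoD(1)[OF tendsto_ident_at])
    thus ?thesis
      by eventually_elim
        (use rs_less_iff[OF assms(1), of "rs q v / 2"] False assms in \<open>smt (verit) half_gt_zero\<close>)
  qed
next
  fix a assume a: "rs q v < a"
  hence "v < H q a" using rs_less_iff[OF assms(1), of a] assms by simp
  hence "\<forall>\<^sub>F y in at v. y < H q a" by (intro order_tendstoD(2)[OF tendsto_ident_at])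
  thus "\<forall>\<^sub>F y in at v. rs q y < a"
    by eventually_elim (use rs_less_iff[OF assms(1), of a] a assms in auto)
qed

text \<open>For \<open>rs q v > 0\<close> this is differentiation of an inverse function.
  Differentiability at every \<open>v\<close>, including the critical level, matters because lines
  used for integration by parts cross the surface \<open>u^2 = 1\<close>.\<close>

lemma M_rs_deriv: assumes q: "0 \<le> q"
  shows "((\<lambda>v. M (rs q v)) has_real_derivative L q v) (at v)"
proof (cases "0 < rs q v")
  case True
  let ?D = "2 * (1 + rs q v powr d) * E q (rs q v) / rs q v"
  have D: "?D \<noteq> 0"
    using E_pos[OF True q] True by (simp add: add_nonneg_eq_0_iff)
  \<comment> \<open>Above this level \<open>rs q\<close> is at least half its value at
    \<open>v\<close>, hence positive, which provides the interval for the inverse function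
    rule.\<close>
  have half: "H q (rs q v / 2) < v"
    using H_strict_mono[OF q, of "rs q v / 2" "rs q v"] H_rs[OF q True] True by simp
  have "(rs q has_real_derivative inverse ?D) (at v)"
  proof (rule DERIV_inverse_function[where f = "H q" and a = "H q (rs q v / 2)" and b = "v + 1"])
    fix y assume "H q (rs q v / 2) < y"
    hence "\<not> rs q y < rs q v / 2" using rs_less_iff[OF q, of "rs q v / 2" y] True by simp
    hence "0 < rs q y" using True by linarith
    thus "H q (rs q y) = y" by (rule H_rs[OF q])
  qed (use H_deriv[OF True] D half rs_isCont[OF q True] in auto)
  from DERIV_chain2[OF M_deriv[OF True] this] show ?thesis
    by (simp add: L_def field_simps)
next
  case False
  hence z: "rs q v = 0" using rs_nonneg[OF q, of v] by linarith
  hence qv: "q = 0" "v \<le> 1" using rs_eq_0_iff[OF q] by auto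
  have "((\<lambda>y. M (rs 0 y)) has_real_derivative 0) (at v)"
  proof (cases "v < 1")
    case True
    have "\<forall>\<^sub>F y in nhds v. M (rs 0 y) = 0"
      using eventually_nhds_in_open[of "{..<1}" v] True
      by (auto elim!: eventually_mono simp: rs_0_eq_0_iff[THEN iffD2] M_nonpos)
    thus ?thesis by (subst DERIV_cong_ev[OF refl _ refl, of _ "\<lambda>_. 0"]) auto
  next
    case False
    hence v: "v = 1" using qv by simp
    \<comment> \<open>For \<open>y > 1\<close> the relation \<open>(1 + r^d)^2 = y\<close> gives
      \<open>r^d \<le> y - 1\<close>, and \<open>1/d \<ge> 2\<close> then gives
      \<open>r \<le> (y - 1)^2\<close>. This quadratic bound makes the derivative at the critical
      level \<open>0\<close> from both sides.\<close>
    have bd: "\<bar>M (rs 0 y)\<bar> \<le> \<nu> * (y - 1)^2" if y: "\<bar>y - 1\<bar> < 1" for y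
    proof (cases "y \<le> 1")
      case True
      thus ?thesis using nu_ge by (simp add: rs_0_eq_0_iff[THEN iffD2] M_nonpos)
    next
      case False
      let ?r = "rs 0 y"
      have r: "0 < ?r" using rs_nonneg[of 0 y] rs_0_eq_0_iff[of y] False by linarith
      have "(1 + ?r powr d)^2 = y" using H_rs[OF _ r] by (simp add: H_def)
      hence "?r powr d \<le> y - 1" 
        by (simp add: power2_sum) (smt (verit) powr_ge_zero zero_le_power2)
      hence "(?r powr d) powr (1/d) \<le> (y - 1) powr (1/d)" using d_pos by (intro powr_mono2) auto
      also have "\<dots> \<le> (y - 1) powr 2" using y False d_pos d_le
        by (intro powr_mono') (auto simp: field_simps)
      finally have "?r \<le> (y - 1)^2" using r d_pos False by (simp add: powr_powr)
      moreover have "\<bar>M ?r\<bar> \<le> \<nu> * ?r" using M_Lipschitz[of ?r 0] r by (simp add: M_nonpos)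
      ultimately show ?thesis using nu_ge by (smt (verit) mult_left_mono)
    qed
    have "((\<lambda>y. (M (rs 0 y) - M (rs 0 1)) / (y - 1)) \<longlongrightarrow> 0) (at 1)"
    proof (rule Lim_null_comparison)
      show "\<forall>\<^sub>F y in at 1. norm ((M (rs 0 y) - M (rs 0 1)) / (y - 1)) \<le> \<nu> * \<bar>y - 1\<bar>"
        unfolding eventually_at
      proof (intro exI[of _ 1] conjI ballI impI)
        fix y :: real assume y: "y \<noteq> 1 \<and> dist y 1 < 1"
        have "\<bar>M (rs 0 y)\<bar> \<le> \<nu> * \<bar>y - 1\<bar> * \<bar>y - 1\<bar>"
          using bd[of y] y by (simp add: dist_real_def power2_eq_square mult.assoc flip: abs_mult)
        thus "norm ((M (rs 0 y) - M (rs 0 1)) / (y - 1)) \<le> \<nu> * \<bar>y - 1\<bar>"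
          using y rs_0_eq_0_iff[of 1] by (simp add: M_nonpos divide_le_eq)
      qed simp
      have "((\<lambda>y::real. \<nu> * \<bar>y - 1\<bar>) \<longlongrightarrow> \<nu> * \<bar>1 - 1\<bar>) (at 1)" by (intro tendsto_intros)
      thus "((\<lambda>y::real. \<nu> * \<bar>y - 1\<bar>) \<longlongrightarrow> 0) (at 1)" by simp
    qed
    thus ?thesis unfolding v has_field_derivative_iff by simp
  qed
  moreover have "L q v = 0" by (simp add: L_def z)
  ultimately show ?thesis using qv by simp
qed

text \<open>By \<open>rs_less_iff\<close> the sublevel sets are explicit, so joint continuity of
  \<open>rs\<close> in both arguments is avoided.\<close>

lemma rs_measurable [measurable]:
  assumes [measurable]: "q \<in> borel_measurable N" "v \<in> borel_measurable N"
    and q: "\<And>x. 0 \<le> q x"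
  shows "(\<lambda>x. rs (q x) (v x)) \<in> borel_measurable N"
  unfolding borel_measurable_iff_less
proof
  fix a
  show "{x \<in> space N. rs (q x) (v x) < a} \<in> sets N"
  proof (cases "0 < a")
    case True
    have "{x \<in> space N. rs (q x) (v x) < a} = {x \<in> space N. v x < H (q x) a}"
      using rs_less_iff[OF q True] by auto
    also have "\<dots> \<in> sets N" unfolding H_def by measurable
    finally show ?thesis .
  next
    case False
    hence "{x \<in> space N. rs (q x) (v x) < a} = {}" using rs_nonneg[OF q]
      by (smt (verit) Collect_empty_eq)
    thus ?thesis by (metis sets.empty_sets)
  qed
qed

text \<open>
  Below, \<open>\<phi> R\<close> is \<open>f'(R) / R\<close> for the radial factor \<open>f R = (1 + R^d) / R\<close> of \<open>u = U R z\<close>, \<open>Uz\<close> is the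
  derivative of \<open>u\<close> in \<open>z\<close>, \<open>Pz\<close> that of \<open>\<psi>\<close> in \<open>z\<close>, and \<open>Psig\<close> is twice that of \<open>\<psi>\<close> in \<open>\<sigma>\<close>.
\<close>

definition U :: "real \<Rightarrow> real \<Rightarrow> real" where
  "U R z = z * (1 + R powr d) / R"

definition \<phi> :: "real \<Rightarrow> real" where
  "\<phi> R = - (1 + (1 - d) * R powr d) / R^3"

definition Uz :: "real \<Rightarrow> real \<Rightarrow> real" where
  "Uz R z = (1 + R powr d) / R + z^2 * \<phi> R"

definition \<psi> :: "real \<Rightarrow> real \<Rightarrow> real \<Rightarrow> real" where
  "\<psi> R z q = U R z * (M R - M (rs q ((U R z)^2)))"

definition Psig :: "real \<Rightarrow> real \<Rightarrow> real \<Rightarrow> real" where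
  "Psig R z q = z * \<phi> R * (M R - M (rs q ((U R z)^2)))
     + U R z * (m (R powr d) / R - 2 * U R z * (z * \<phi> R) * L q ((U R z)^2))"

definition Pz :: "real \<Rightarrow> real \<Rightarrow> real \<Rightarrow> real" where
  "Pz R z q = Uz R z * (M R - M (rs q ((U R z)^2)))
     + U R z * (m (R powr d) * z / R - 2 * U R z * Uz R z * L q ((U R z)^2))"

end

section \<open>Pointwise estimates\<close>

locale profile_point = profile +
  fixes R z q \<sigma> :: real
  assumes R_pos: "0 < R" and R_le: "R \<le> 1" and q_nonneg: "0 \<le> q" and \<sigma>_nonneg: "0 \<le> \<sigma>"
    and R_eq: "R^2 = \<sigma> + z^2 + q"
begin

abbreviation "X \<equiv> R powr d"
abbreviation "r \<equiv> rs q ((U R z)^2)"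
abbreviation "Y \<equiv> r powr d"
text \<open>Since \<open>w = 1 - z^2 / R^2\<close> (see \<open>z2\<close>), this is the squared sine
  of the angle to the \<open>z\<close>-axis. The primed version is its value at the point of radius
  \<open>r\<close> where the level meets the axis \<open>\<sigma> = 0\<close>.\<close>

definition "w = (q + \<sigma>) / R^2"
definition "w' = q / r^2"

lemma X_bounds: "0 < X" "X \<le> 1"
  using R_pos R_le d_pos by (auto simp: powr_le1)

lemma w_bounds: "0 \<le> w" "w \<le> 1"
proof -
  have "q + \<sigma> \<le> R^2" unfolding R_eq by simp
  thus "w \<le> 1" using R_pos by (simp add: w_def divide_le_eq)
qed (use q_nonneg \<sigma>_nonneg in \<open>simp add: w_def\<close>)

lemma z2: "z^2 = R^2 * (1 - w)"
proof -
  have "R^2 * w = q + \<sigma>" using R_pos by (simp add: w_def)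
  thus ?thesis using R_eq by (simp add: algebra_simps)
qed

lemma U2: "(U R z)^2 = (1 + X)^2 * (1 - w)"
  using R_pos by (simp add: U_def z2 power_mult_distrib power_divide)

lemma U2_eq_H: "(U R z)^2 = H (q + \<sigma>) R"
  by (simp add: U2 H_def w_def)

lemma r_bounds: "0 \<le> r" "r \<le> R"
proof -
  show "0 \<le> r" by (rule rs_nonneg[OF q_nonneg])
  \<comment> \<open>Moving to the axis with \<open>R\<close> and \<open>q\<close> fixed cannot
    decrease \<open>u^2\<close>, so the axis reaches the same level at a radius no larger than
    \<open>R\<close>.\<close>
  have "H (q + \<sigma>) R \<le> H q R"
    unfolding H_def using \<sigma>_nonneg R_pos
    by (intro mult_left_mono diff_left_mono divide_right_mono) auto
  hence "r < a" if "R < a" for a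
    using rs_less_iff[OF q_nonneg, of a] H_strict_mono[OF q_nonneg R_pos that] R_pos that
    by (simp add: U2_eq_H)
  thus "r \<le> R" by (meson dense_ge_bounded lt_ex not_le_imp_less order.irrefl)
qed

lemma Y_bounds: "0 \<le> Y" "Y \<le> X" "Y \<le> 1"
proof -
  show "Y \<le> X" using r_bounds d_pos by (intro powr_mono2) auto
  thus "Y \<le> 1" using X_bounds by linarith
qed simp

lemma r_zero: assumes "r = 0" shows "q = 0" "(U R z)^2 \<le> 1" "Y = 0" "L q ((U R z)^2) = 0"
  using assms rs_eq_0_iff[OF q_nonneg, of "(U R z)^2"] by (auto simp: L_def)

lemma level_eq: assumes "0 < r" shows "(1 + Y)^2 * (1 - w') = (1 + X)^2 * (1 - w)"
  using H_rs[OF q_nonneg assms] by (simp add: H_def U2 w'_def)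

lemma w'_bounds: assumes "0 < r" shows "0 \<le> w'" "w' \<le> 1"
proof -
  show "0 \<le> w'" using q_nonneg by (simp add: w'_def)
  have "0 \<le> (1 + Y)^2 * (1 - w')" using level_eq[OF assms] w_bounds by simp
  moreover have "0 < (1 + Y)^2" using Y_bounds(1) by (simp add: add_nonneg_eq_0_iff)
  ultimately show "w' \<le> 1" by (simp add: zero_le_mult_iff)
qed

text \<open>With \<open>t = r / R\<close> in \<open>[0, 1]\<close> one has
  \<open>Y = t^d * X\<close>, and the bounds express \<open>t \<le> t^d\<close> and the tangent line
  estimate \<open>t^d \<le> d * t + 1 - d\<close>.\<close>

lemma radius_ratio: "r / R * X \<le> Y" "d * X * (1 - r / R) \<le> X - Y"
proof -
  let ?t = "r / R"
  have t: "0 \<le> ?t" "?t \<le> 1" using r_bounds R_pos by auto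
  have Y: "Y = ?t powr d * X" using r_bounds R_pos by (simp add: powr_divide)
  have "?t \<le> ?t powr d"
    using powr_mono'[of d 1 ?t] t d_le powr_one[OF t(1)] by linarith
  thus "r / R * X \<le> Y" unfolding Y using X_bounds by (intro mult_right_mono) auto
  have "?t powr d \<le> d * ?t + (1 - d)"
    using Youngs_inequality_0[of d "1 - d" ?t 1] t d_pos d_le by (cases "?t = 0") auto
  hence "?t powr d * X \<le> (d * ?t + (1 - d)) * X" using X_bounds by (intro mult_right_mono) auto
  thus "d * X * (1 - r / R) \<le> X - Y" unfolding Y by (simp add: algebra_simps)
qed

lemma sq_diff: "(1 + X)^2 - (1 + Y)^2 = (X - Y) * (2 + X + Y)"
  by (simp add: power2_eq_square algebra_simps)

text \<open>For \<open>r = 0\<close> it follows from \<open>u^2 \<le> 1\<close>. Otherwise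
  \<open>level_eq\<close> splits \<open>(1 + X)^2 * \<sigma> / R^2\<close> into two nonnegative
  terms: one contains \<open>X - Y\<close> with weight \<open>1 - q / R^2\<close>, the other
  \<open>w' - q / R^2\<close>. If \<open>q \<le> R^2 / 2\<close>, the first term suffices. If not,
  its weight may vanish, and the second term controls \<open>(R / r)^2 - 1\<close> and thereby
  \<open>1 - r / R\<close>.\<close>

lemma powr_diff_le: "X - Y \<le> 8 * \<sigma> / R^2"
proof -
  have X4: "(1 + X)^2 \<le> 4" using power_mono[of "1 + X" 2 2] X_bounds by simp
  have s: "0 \<le> \<sigma> / R^2" using \<sigma>_nonneg by simp
  have X4': "(1 + X)^2 * (\<sigma> / R^2) \<le> 4 * (\<sigma> / R^2)"
    by (rule mult_right_mono[OF X4 s])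
  have weq: "w = q / R^2 + \<sigma> / R^2" by (simp add: w_def add_divide_distrib)
  have XY: "2 * (X - Y) \<le> (1 + X)^2 - (1 + Y)^2"
    unfolding sq_diff using Y_bounds X_bounds mult_left_mono[of 2 "2 + X + Y" "X - Y"] by simp
  show ?thesis
  proof (cases "r = 0")
    case True
    from r_zero[OF this] have "(1 + X)^2 * (1 - \<sigma> / R^2) \<le> 1" "Y = 0"
      using U2 weq by auto
    hence "(1 + X)^2 - (1 + Y)^2 \<le> (1 + X)^2 * (\<sigma> / R^2)" by (simp add: algebra_simps)
    thus ?thesis using XY X4' s by simp
  next
    case False
    hence r: "0 < r" using r_bounds by simp
    have w'w: "q / R^2 \<le> w'" unfolding w'_def
      using q_nonneg r r_bounds R_pos by (intro divide_left_mono power_mono) auto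
    have eq: "((1 + X)^2 - (1 + Y)^2) * (1 - q / R^2) + (1 + Y)^2 * (w' - q / R^2)
        = (1 + X)^2 * (\<sigma> / R^2)"
      using level_eq[OF r] unfolding weq by (simp add: algebra_simps)
    have q1: "q / R^2 \<le> 1" using w_bounds(2) weq s by linarith
    show ?thesis
    proof (cases "q / R^2 \<le> 1/2")
      case True
      have "0 \<le> (1 + Y)^2 * (w' - q / R^2)" using w'w by simp
      hence A: "((1 + X)^2 - (1 + Y)^2) * (1 - q / R^2) \<le> 4 * (\<sigma> / R^2)"
        using eq X4' by linarith
      have B: "((1 + X)^2 - (1 + Y)^2) * (1 / 2) \<le> ((1 + X)^2 - (1 + Y)^2) * (1 - q / R^2)"
        using True XY Y_bounds by (intro mult_left_mono) auto
      have C: "X - Y \<le> ((1 + X)^2 - (1 + Y)^2) * (1 / 2)" using XY by simp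
      have "X - Y \<le> 4 * (\<sigma> / R^2)" by (rule order.trans[OF C order.trans[OF B A]])
      also have "\<dots> \<le> 8 * (\<sigma> / R^2)" using s by simp
      finally show ?thesis by simp
    next
      case F: False
      have P: "0 \<le> ((1 + X)^2 - (1 + Y)^2) * (1 - q / R^2)"
        using XY Y_bounds q1 by (intro mult_nonneg_nonneg) auto
      have Q: "1 * (w' - q / R^2) \<le> (1 + Y)^2 * (w' - q / R^2)"
        using w'w Y_bounds by (intro mult_right_mono) (auto simp: power2_sum)
      have T: "(1 + Y)^2 * (w' - q / R^2) \<le> (1 + X)^2 * (\<sigma> / R^2)"
        unfolding eq[symmetric] using P by (rule le_add_same_cancel2[THEN iffD2])
      have 1: "w' - q / R^2 \<le> 4 * (\<sigma> / R^2)"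
        using order.trans[OF Q order.trans[OF T X4']] by simp
      have w': "w' = q / R^2 * (R / r)^2" using r R_pos by (simp add: w'_def power_divide)
      have Rr: "1 \<le> R / r" using r r_bounds by simp
      hence Rr2: "1 \<le> (R / r)^2" by (rule one_le_power)
      have "1/2 * ((R / r)^2 - 1) \<le> q / R^2 * ((R / r)^2 - 1)"
        using F Rr2 by (intro mult_right_mono) auto
      also have "\<dots> = w' - q / R^2" by (simp add: w' algebra_simps)
      finally have "1/2 * ((R / r)^2 - 1) \<le> w' - q / R^2" .
      moreover have "1/2 * a \<le> b \<Longrightarrow> a \<le> 2 * b" for a b :: real by simp
      ultimately have "(R / r)^2 - 1 \<le> 2 * (w' - q / R^2)" by blast
      also have "\<dots> \<le> 2 * (4 * (\<sigma> / R^2))" using 1 by (intro mult_left_mono) auto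
      finally have 2: "(R / r)^2 - 1 \<le> 8 * (\<sigma> / R^2)" by simp
      have "X - Y \<le> X * (1 - r / R)" using radius_ratio(1) by (simp add: algebra_simps)
      also have "\<dots> \<le> 1 * (1 - r / R)" using X_bounds r_bounds R_pos by (intro mult_right_mono) auto
      also have "1 - r / R \<le> R / r - 1"
      proof -
        have "(R / r + r / R - 2) * (r * R) = (R - r)^2"
          using r R_pos by (simp add: field_simps power2_eq_square)
        hence "0 \<le> (R / r + r / R - 2) * (r * R)" by simp
        moreover have "0 < r * R" using r R_pos by simp
        ultimately have "0 \<le> R / r + r / R - 2" by (simp add: zero_le_mult_iff)
        thus ?thesis by simp
      qed
      also have "\<dots> \<le> (R / r)^2 - 1" using self_le_power[OF Rr, of 2] by simp
      finally show ?thesis using 2 by simp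
    qed
  qed
qed

text \<open>
  Both \<open>\<psi>\<close> and \<open>Pz\<close> turn out to be controlled by \<open>\<eta>\<close>, which vanishes on the axis.
\<close>

definition "\<eta> = (X - Y) / X"

lemma \<eta>_bounds: "0 \<le> \<eta>" "\<eta> \<le> 1" "\<eta> \<le> 8 * \<sigma> / (R^2 * X)"
proof -
  show "0 \<le> \<eta>" "\<eta> \<le> 1" using Y_bounds X_bounds by (auto simp: \<eta>_def)
  have "\<eta> \<le> (8 * \<sigma> / R^2) / X"
    unfolding \<eta>_def using powr_diff_le X_bounds by (intro divide_right_mono) auto
  thus "\<eta> \<le> 8 * \<sigma> / (R^2 * X)" by (simp add: mult.commute)
qed

lemma one_minus_ratio: "1 - r / R \<le> \<eta> / d"
proof -
  have "(1 - r / R) * (d * X) \<le> X - Y" using radius_ratio(2) by (simp add: mult_ac)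
  hence "1 - r / R \<le> (X - Y) / (d * X)" using d_pos X_bounds by (simp add: pos_le_divide_eq)
  thus ?thesis by (simp add: \<eta>_def mult.commute)
qed

lemma M_diff: "\<bar>M R - M r\<bar> \<le> \<nu> / d * R * \<eta>"
proof -
  have "\<bar>M R - M r\<bar> \<le> \<nu> * (R - r)"
    using M_Lipschitz[of R r] R_pos r_bounds by simp
  also have "\<nu> * (R - r) = \<nu> * R * (1 - r / R)" using R_pos by (simp add: algebra_simps)
  also have "\<dots> \<le> \<nu> * R * (\<eta> / d)"
    using one_minus_ratio nu_ge R_pos by (intro mult_left_mono) auto
  finally show ?thesis by (simp add: mult_ac)
qed

section \<open>Bounds for the stream function and its derivatives\<close>

lemma U_bound: "\<bar>U R z\<bar> \<le> 2"
proof -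
  have "(U R z)^2 \<le> 2^2 * 1"
    unfolding U2 using X_bounds w_bounds by (intro mult_mono power_mono) auto
  thus ?thesis using abs_le_square_iff[of "U R z" 2] by simp
qed

lemma \<psi>_bound: "\<bar>\<psi> R z q\<bar> \<le> 2 * \<nu> / d * R * \<eta>"
proof -
  have "\<bar>\<psi> R z q\<bar> \<le> 2 * (\<nu> / d * R * \<eta>)"
    unfolding \<psi>_def abs_mult using U_bound M_diff by (intro mult_mono) auto
  thus ?thesis by simp
qed

lemma z_le: "\<bar>z\<bar> \<le> R"
  using R_eq q_nonneg \<sigma>_nonneg R_pos abs_le_square_iff[of z R] by simp

lemma z\<phi>_bound: "\<bar>z * \<phi> R\<bar> \<le> 2 / R^2"
proof -
  have 1: "\<bar>1 + (1 - d) * X\<bar> \<le> 2"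
    using X_bounds d_pos d_le mult_mono[of "1 - d" 1 X 1] by simp
  have "\<bar>z * \<phi> R\<bar> = \<bar>z\<bar> * \<bar>1 + (1 - d) * X\<bar> / R^3"
    unfolding \<phi>_def using R_pos by (simp only: abs_mult abs_divide abs_minus_cancel) simp
  also have "\<dots> \<le> R * 2 / R^3"
    using z_le 1 R_pos by (intro divide_right_mono mult_mono) auto
  finally show ?thesis using R_pos by (simp add: power3_eq_cube power2_eq_square)
qed

text \<open>The function \<open>E\<close> in the variables \<open>R powr d\<close> and
  \<open>q / R^2\<close>. Evaluated at \<open>w\<close> it also yields \<open>Uz\<close>, so the
  derivative of \<open>u\<close> at the given point and the denominator of \<open>L\<close> at the
  axis point become values of one function.\<close>

definition "Ew x y = d * x + (1 + (1 - d) * x) * y"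

lemma Uz_eq: "Uz R z = Ew X w / R"
  using R_pos unfolding Uz_def \<phi>_def Ew_def z2
  by (simp add: field_simps power3_eq_cube power2_eq_square)

lemma Ew_bounds: "0 \<le> Ew X w" "Ew X w \<le> 3"
proof -
  show "0 \<le> Ew X w" unfolding Ew_def using X_bounds w_bounds d_pos d_le by simp
  have "d * X \<le> 1 * 1" "(1 + (1 - d) * X) * w \<le> (1 + 1 * 1) * 1"
    using X_bounds w_bounds d_pos d_le by (intro mult_mono add_mono; simp)+
  from add_mono[OF this] show "Ew X w \<le> 3" unfolding Ew_def by simp
qed

lemma L_eq: "L q ((U R z)^2) = m Y * r / (2 * (1 + Y) * Ew Y w')"
  by (simp add: L_def E_def Ew_def w'_def)

lemma Ew'_ge: assumes "0 < r" shows "d * Y \<le> Ew Y w'" "0 < Ew Y w'"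
  using E_pos[OF assms q_nonneg] by (auto simp: E_def Ew_def w'_def)

text \<open>Because \<open>r^(1-d)\<close> increases with \<open>r\<close>, the loss at the axis
  point is no worse than at radius \<open>R\<close>.\<close>

lemma r_over_Ew': assumes "0 < r" shows "r / Ew Y w' \<le> R / (d * X)"
proof -
  have dY: "0 < d * Y" using assms d_pos by simp
  have "r / Ew Y w' \<le> r / (d * Y)"
    using Ew'_ge[OF assms] r_bounds dY by (intro divide_left_mono) auto
  also have "\<dots> = r * X / (d * X * Y)" using X_bounds by simp
  also have "\<dots> \<le> R * Y / (d * X * Y)"
    using radius_ratio(1) R_pos X_bounds Y_bounds d_pos
    by (intro divide_right_mono) (auto simp: field_simps)
  also have "\<dots> = R / (d * X)" using dY by (intro nonzero_mult_divide_mult_cancel_right) auto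
  finally show ?thesis .
qed

lemma L_bound: "\<bar>L q ((U R z)^2)\<bar> \<le> \<nu> * R / (d * X)"
proof (cases "r = 0")
  case True
  thus ?thesis using r_zero R_pos X_bounds d_pos nu_ge by simp
next
  case False
  hence r: "0 < r" using r_bounds by simp
  have E: "0 < Ew Y w'" by (rule Ew'_ge[OF r])
  have "\<bar>L q ((U R z)^2)\<bar> = (\<bar>m Y\<bar> / (2 * (1 + Y))) * (r / Ew Y w')"
    unfolding L_eq using r E Y_bounds by (simp add: abs_mult)
  also have "\<dots> \<le> \<nu> * (R / (d * X))"
  proof (intro mult_mono r_over_Ew' r)
    have "\<bar>m Y\<bar> / (2 * (1 + Y)) \<le> \<nu> / 1"
      using m_bound[OF Y_bounds(1)] Y_bounds nu_ge by (intro frac_le) auto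
    thus "\<bar>m Y\<bar> / (2 * (1 + Y)) \<le> \<nu>" by simp
  qed (use nu_ge r E in auto)
  finally show ?thesis by simp
qed

lemma Psig_bound: "\<bar>Psig R z q\<bar> \<le> 20 * \<nu> / d / (R * X)"
proof -
  have dX: "0 < d * X" "d * X \<le> 1" using d_pos d_le X_bounds mult_mono[of d 1 X 1] by auto
  have base: "0 \<le> \<nu> / (R * (d * X))" using nu_ge R_pos dX by simp
  have "\<bar>z * \<phi> R * (M R - M r)\<bar> \<le> 2 / R^2 * (\<nu> / d * R * 1)"
    unfolding abs_mult[of "z * \<phi> R"]
    using z\<phi>_bound order.trans[OF M_diff mult_left_mono[OF \<eta>_bounds(2)]] nu_ge d_pos R_pos
    by (intro mult_mono) auto
  also have "\<dots> = 2 * (\<nu> / (R * (d * X))) * X"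
    using R_pos d_pos X_bounds by (simp add: power2_eq_square)
  also have "\<dots> \<le> 2 * (\<nu> / (R * (d * X))) * 1" using X_bounds base by (intro mult_left_mono) auto
  finally have 1: "\<bar>z * \<phi> R * (M R - M r)\<bar> \<le> 2 * (\<nu> / (R * (d * X)))" by simp
  have "\<bar>m X / R\<bar> \<le> \<nu> / R"
    using m_bound[of X] X_bounds R_pos by (simp add: divide_right_mono)
  also have "\<dots> = \<nu> / (R * (d * X)) * (d * X)" using dX d_pos X_bounds by simp
  also have "\<dots> \<le> \<nu> / (R * (d * X)) * 1" using dX base by (intro mult_left_mono) auto
  finally have 2: "\<bar>m X / R\<bar> \<le> \<nu> / (R * (d * X))" by simp
  have "\<bar>2 * U R z * (z * \<phi> R) * L q ((U R z)^2)\<bar> \<le> (2 * 2) * (2 / R^2) * (\<nu> * R / (d * X))"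
    unfolding abs_mult[of "2 * U R z * (z * \<phi> R)"] abs_mult[of "2 * U R z"]
    using L_bound z\<phi>_bound U_bound by (intro mult_mono) (auto simp: abs_mult)
  also have "\<dots> = 8 * (\<nu> / (R * (d * X)))" using R_pos by (simp add: power2_eq_square)
  finally have 3: "\<bar>2 * U R z * (z * \<phi> R) * L q ((U R z)^2)\<bar> \<le> 8 * (\<nu> / (R * (d * X)))" .
  have "\<bar>m X / R - 2 * U R z * (z * \<phi> R) * L q ((U R z)^2)\<bar> \<le> 9 * (\<nu> / (R * (d * X)))"
    using 2 3 by linarith
  hence "\<bar>U R z * (m X / R - 2 * U R z * (z * \<phi> R) * L q ((U R z)^2))\<bar>
      \<le> 2 * (9 * (\<nu> / (R * (d * X))))"
    unfolding abs_mult[of "U R z"] using U_bound base by (intro mult_mono) auto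
  hence "\<bar>Psig R z q\<bar> \<le> 20 * (\<nu> / (R * (d * X)))"
    unfolding Psig_def using 1 by linarith
  thus ?thesis by (simp add: mult_ac)
qed

definition "j x y = (1 + x) * (1 - y) * m x"

text \<open>Exhibits the second summand of \<open>Pz\<close> as a difference of corresponding
  quantities at the given point and at the axis point of its level; on the axis the two points
  coincide. This is the cancellation that makes \<open>Pz\<close> vanish there.\<close>

lemma uT_eq: "U R z * (m X * z / R - 2 * U R z * Uz R z * L q ((U R z)^2))
    = j X w - Ew X w * (r / Ew Y w') / R * j Y w'"
proof -
  have 1: "U R z * (m X * z / R) = j X w"
  proof -
    have "U R z * (m X * z / R) = z^2 * ((1 + X) * m X) / R^2"
      by (simp add: U_def power2_eq_square)
    thus ?thesis unfolding z2 using R_pos by (simp add: j_def)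
  qed
  have 2: "U R z * (2 * U R z * Uz R z * L q ((U R z)^2)) = Ew X w * (r / Ew Y w') / R * j Y w'"
  proof (cases "r = 0")
    case True
    thus ?thesis using r_zero by simp
  next
    case False
    hence r: "0 < r" using r_bounds by simp
    have U2': "(U R z)^2 = (1 + Y)^2 * (1 - w')" using U2 level_eq[OF r] by simp
    have "U R z * (2 * U R z * Uz R z * L q ((U R z)^2)) = 2 * (U R z)^2 * Uz R z * L q ((U R z)^2)"
      by (simp add: power2_eq_square)
    also have "\<dots> = 2 * (U R z)^2 * (Ew X w / R) * (m Y * r / (2 * (1 + Y) * Ew Y w'))"
      by (simp only: L_eq Uz_eq)
    also have "\<dots> = 2 * ((1 + Y)^2 * (1 - w')) * (Ew X w / R) * (m Y * r / (2 * (1 + Y) * Ew Y w'))"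
      by (rule arg_cong[OF U2', of "\<lambda>a. 2 * a * (Ew X w / R) * (m Y * r / (2 * (1 + Y) * Ew Y w'))"])
    also have "\<dots> = Ew X w * (r / Ew Y w') / R * ((1 + Y) * (1 - w') * m Y)"
    proof -
      have "2 * (c^2 * a) * (e / R) * (b * r / (2 * c * f)) = e * (r / f) / R * (c * a * b)"
        if "c \<noteq> 0" for a b c e f
        using that by (simp add: power2_eq_square mult_ac)
      moreover have "1 + Y \<noteq> 0" using Y_bounds(1) by linarith
      ultimately show ?thesis by blast
    qed
    finally show ?thesis by (simp add: j_def)
  qed
  show ?thesis unfolding right_diff_distrib 1 2 ..
qed

lemma times_div_square: "0 \<le> x \<Longrightarrow> (1 + x) * (- N / (1 + x)^2) = - (N / (1 + x))" for x N :: real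
  by (simp add: power2_eq_square add_nonneg_eq_0_iff)

lemma j_bound: assumes "0 \<le> x" "0 \<le> y" "y \<le> 1" shows "\<bar>j x y\<bar> \<le> \<nu>"
proof -
  have "\<bar>(1 + x) * m x\<bar> \<le> \<nu>"
  proof -
    have "(1 - d) * (\<nu> - 1 + d) * x \<le> \<nu> * x"
      using coeff_bounds assms by (intro mult_right_mono) auto
    hence "(\<nu> - 1) + (1 - d) * (\<nu> - 1 + d) * x \<le> \<nu> * (1 + x)" by (simp add: algebra_simps)
    moreover have "0 \<le> (\<nu> - 1) + (1 - d) * (\<nu> - 1 + d) * x"
      using coeff_bounds assms nu_ge by simp
    moreover have "(1 + x) * m x = - (((\<nu> - 1) + (1 - d) * (\<nu> - 1 + d) * x) / (1 + x))"
      unfolding m_def by (rule times_div_square[OF assms(1)])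
    ultimately show ?thesis using assms by (simp add: divide_le_eq)
  qed
  hence "\<bar>(1 + x) * m x\<bar> * \<bar>1 - y\<bar> \<le> \<nu> * 1" using assms by (intro mult_mono) auto
  thus ?thesis by (simp add: j_def abs_mult mult_ac)
qed

lemma w_diff: assumes "0 < r" shows "\<bar>w - w'\<bar> \<le> 4 * (X - Y)"
proof -
  have "(1 + X)^2 * (w - w') = ((1 + X)^2 - (1 + Y)^2) * (1 - w')"
    using level_eq[OF assms] by (simp add: algebra_simps)
  hence "(1 + X)^2 * \<bar>w - w'\<bar> = \<bar>((1 + X)^2 - (1 + Y)^2) * (1 - w')\<bar>"
    by (metis abs_mult abs_power2)
  also have "\<dots> = (X - Y) * (2 + X + Y) * (1 - w')"
    unfolding sq_diff using Y_bounds X_bounds w'_bounds[OF assms] by (simp add: abs_mult)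
  also have "\<dots> \<le> (X - Y) * 4 * 1"
    using Y_bounds X_bounds w'_bounds[OF assms] by (intro mult_mono) auto
  finally have "(1 + X)^2 * \<bar>w - w'\<bar> \<le> 4 * (X - Y)" by simp
  note A = this
  have B: "1 * \<bar>w - w'\<bar> \<le> (1 + X)^2 * \<bar>w - w'\<bar>"
    using X_bounds by (intro mult_right_mono) (auto simp: power2_sum)
  show ?thesis using order.trans[OF B A] by simp
qed

lemma j_diff: assumes "0 < r" shows "\<bar>j X w - j Y w'\<bar> \<le> 5 * \<nu> * (X - Y)"
proof -
  let ?A = "\<nu> - 1" and ?B = "(1 - d) * (\<nu> - 1 + d)"
  let ?f = "\<lambda>x. (1 + x) * m x"
  have f: "?f x = - (?A + ?B * x) / (1 + x)" if "0 \<le> x" for x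
    unfolding m_def using that by (simp add: power2_eq_square add_nonneg_eq_0_iff)
  have "?f X - ?f Y = (?A - ?B) * (X - Y) / ((1 + X) * (1 + Y))"
    using X_bounds Y_bounds(1) unfolding f[OF Y_bounds(1)] f[OF less_imp_le[OF X_bounds(1)]]
    by (simp add: divide_simps add_nonneg_eq_0_iff) (simp add: algebra_simps)
  hence "\<bar>?f X - ?f Y\<bar> = \<bar>?A - ?B\<bar> * (X - Y) / ((1 + X) * (1 + Y))"
    using X_bounds Y_bounds by (simp add: abs_mult)
  also have "\<dots> \<le> \<nu> * (X - Y) / 1"
  proof (intro frac_le mult_mono)
    show "\<bar>?A - ?B\<bar> \<le> \<nu>" by (rule coeff_bounds)
    show "1 \<le> (1 + X) * (1 + Y)"
      using mult_mono[of 1 "1 + X" 1 "1 + Y"] X_bounds Y_bounds by simp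
  qed (use X_bounds Y_bounds nu_ge in auto)
  finally have 1: "\<bar>?f X - ?f Y\<bar> \<le> \<nu> * (X - Y)" by simp
  have fY: "\<bar>?f Y\<bar> \<le> \<nu>" using j_bound[of Y 0] Y_bounds by (simp add: j_def)
  have "\<bar>(?f X - ?f Y) * (1 - w)\<bar> \<le> \<nu> * (X - Y) * 1"
    unfolding abs_mult[of "?f X - ?f Y"] using 1 w_bounds Y_bounds nu_ge by (intro mult_mono) auto
  note 2 = this
  have 3: "\<bar>?f Y * (w - w')\<bar> \<le> \<nu> * (4 * (X - Y))"
    unfolding abs_mult[of "?f Y"] using fY w_diff[OF assms] nu_ge by (intro mult_mono) auto
  have 4: "j X w - j Y w' = (?f X - ?f Y) * (1 - w) - ?f Y * (w - w')"
    by (simp add: j_def algebra_simps)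
  have "\<bar>j X w - j Y w'\<bar> \<le> \<nu> * (X - Y) * 1 + \<nu> * (4 * (X - Y))"
    unfolding 4 by (rule order.trans[OF abs_triangle_ineq4 add_mono[OF 2 3]])
  thus ?thesis by (simp add: algebra_simps)
qed

lemma Ew_diff: assumes "0 < r" shows "\<bar>Ew X w - Ew Y w'\<bar> \<le> 10 * (X - Y)"
proof -
  have 0: "Ew X w - Ew Y w' = d * (X - Y) + (1 + (1 - d) * X) * (w - w') + (1 - d) * (X - Y) * w'"
    by (simp add: Ew_def algebra_simps)
  have 1: "\<bar>d * (X - Y)\<bar> \<le> 1 * (X - Y)"
    unfolding abs_mult using d_pos d_le Y_bounds by (intro mult_mono) auto
  have 2: "\<bar>(1 + (1 - d) * X) * (w - w')\<bar> \<le> (1 + 1 * 1) * (4 * (X - Y))"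
    unfolding abs_mult[of "1 + (1 - d) * X"] using w_diff[OF assms] d_pos d_le X_bounds
    by (intro mult_mono) (auto intro!: mult_le_one simp: abs_of_nonneg)
  have 3: "\<bar>(1 - d) * (X - Y) * w'\<bar> \<le> 1 * (X - Y) * 1"
    unfolding abs_mult using d_pos d_le Y_bounds w'_bounds[OF assms] by (intro mult_mono) auto
  have "\<bar>Ew X w - Ew Y w'\<bar> \<le> 1 * (X - Y) + (1 + 1 * 1) * (4 * (X - Y)) + 1 * (X - Y) * 1"
    unfolding 0 by (rule abs_add3[OF 1 2 3])
  thus ?thesis by simp
qed

text \<open>For \<open>r = 0\<close> one has \<open>\<eta> = 1\<close> and no cancellation is
  required. For \<open>r > 0\<close> the difference in \<open>uT_eq\<close> is split into the
  changes of \<open>j\<close>, of the radius and of \<open>Ew\<close>, contributing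
  \<open>5\<close>, \<open>1\<close> and \<open>10\<close> times
  \<open>\<nu> / d * \<eta>\<close>.\<close>

lemma uT_bound: "\<bar>U R z * (m X * z / R - 2 * U R z * Uz R z * L q ((U R z)^2))\<bar> \<le> 16 * \<nu> / d * \<eta>"
proof (cases "r = 0")
  case True
  hence "\<eta> = 1" unfolding \<eta>_def True using X_bounds d_pos by simp
  moreover have "\<bar>j X w\<bar> \<le> \<nu>" using j_bound X_bounds w_bounds by simp
  moreover have "\<nu> \<le> 16 * \<nu> / d"
    using d_pos d_le nu_ge by (simp add: field_simps)
  ultimately show ?thesis unfolding uT_eq using True by simp
next
  case False
  hence r: "0 < r" using r_bounds by simp
  have E: "0 < Ew Y w'" by (rule Ew'_ge[OF r])
  have jY: "\<bar>j Y w'\<bar> \<le> \<nu>" using j_bound Y_bounds w'_bounds[OF r] by simp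
  have XY: "X - Y = X * \<eta>" using X_bounds by (simp add: \<eta>_def)
  have XY1: "X - Y \<le> 1 / d * \<eta>"
  proof -
    have "X * \<eta> \<le> 1 / d * \<eta>"
      using X_bounds \<eta>_bounds d_pos d_le mult_le_one[of d X]
      by (intro mult_right_mono) (auto simp: pos_le_divide_eq mult.commute)
    thus ?thesis using XY by simp
  qed
  have "Ew X w * (r / Ew Y w') / R = (Ew X w - Ew Y w') * (r / Ew Y w') / R + r / R"
    using E by (simp add: left_diff_distrib diff_divide_distrib)
  hence split: "j X w - Ew X w * (r / Ew Y w') / R * j Y w' = (j X w - j Y w') + (1 - r / R) * j Y w'
      - (Ew X w - Ew Y w') * (r / Ew Y w' / R) * j Y w'"
    by (simp add: algebra_simps)
  have \<nu>XY: "\<nu> * (X - Y) \<le> \<nu> * (1 / d * \<eta>)" using XY1 nu_ge by (intro mult_left_mono) auto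
  hence 1: "\<bar>j X w - j Y w'\<bar> \<le> 5 * (\<nu> / d * \<eta>)"
  proof -
    have "5 * \<nu> * (X - Y) \<le> 5 * (\<nu> / d * \<eta>)"
      using mult_left_mono[OF \<nu>XY, of 5] by (simp add: mult.assoc)
    thus ?thesis by (rule order.trans[OF j_diff[OF r]])
  qed
  have "\<bar>(1 - r / R) * j Y w'\<bar> \<le> \<eta> / d * \<nu>"
    unfolding abs_mult using one_minus_ratio jY r_bounds R_pos \<eta>_bounds d_pos
    by (intro mult_mono) auto
  hence 2: "\<bar>(1 - r / R) * j Y w'\<bar> \<le> \<nu> / d * \<eta>" by (simp add: mult_ac)
  have rE: "r / Ew Y w' / R \<le> 1 / (d * X)"
    using divide_right_mono[OF r_over_Ew'[OF r], of R] R_pos by simp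
  have "\<bar>(Ew X w - Ew Y w') * (r / Ew Y w' / R) * j Y w'\<bar> \<le> 10 * (X - Y) * (1 / (d * X)) * \<nu>"
    unfolding abs_mult[of "_ * _"] abs_mult[of "Ew X w - Ew Y w'"]
    using Ew_diff[OF r] rE jY R_pos r E Y_bounds X_bounds d_pos
    by (intro mult_mono) auto
  also have "\<dots> = 10 * (\<nu> / d * \<eta>)" using X_bounds by (simp add: XY)
  finally have 3: "\<bar>(Ew X w - Ew Y w') * (r / Ew Y w' / R) * j Y w'\<bar> \<le> 10 * (\<nu> / d * \<eta>)" .
  have "\<bar>j X w - Ew X w * (r / Ew Y w') / R * j Y w'\<bar> \<le> 16 * (\<nu> / d * \<eta>)"
    unfolding split using abs_add3[OF 1 2, of "- _", unfolded abs_minus_cancel, OF 3] by simp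
  thus ?thesis unfolding uT_eq by simp
qed

lemma Pz_bound: "\<bar>Pz R z q\<bar> \<le> 19 * \<nu> / d * \<eta>"
proof -
  have Uz: "\<bar>Uz R z\<bar> \<le> 3 / R"
    unfolding Uz_eq using Ew_bounds R_pos by (simp add: divide_right_mono)
  have "\<bar>Uz R z * (M R - M r)\<bar> \<le> 3 / R * (\<nu> / d * R * \<eta>)"
    unfolding abs_mult using Uz M_diff R_pos by (intro mult_mono) auto
  also have "\<dots> = 3 * \<nu> / d * \<eta>" using R_pos by simp
  finally have "\<bar>Pz R z q\<bar> \<le> 3 * \<nu> / d * \<eta> + 16 * \<nu> / d * \<eta>"
    unfolding Pz_def by (rule order.trans[OF abs_triangle_ineq add_mono[OF _ uT_bound]])
  thus ?thesis by (simp add: algebra_simps add_divide_distrib)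
qed

text \<open>Interpolation between the bound \<open>1\<close> and the bound linear in
  \<open>\<sigma>\<close>, through \<open>\<eta>^2 \<le> \<eta>\<close>. In the drift,
  \<open>Pz / \<sigma>\<close> multiplies a vector of length \<open>sqrt \<sigma>\<close>, so decay
  like \<open>sqrt \<sigma>\<close> is what makes that component bounded near the axis away from the
  origin.\<close>

lemma \<eta>_\<sigma>: "\<eta> \<le> 3 * sqrt \<sigma> / (R * X)"
proof -
  have "\<eta>^2 \<le> \<eta> * 1" unfolding power2_eq_square using \<eta>_bounds by (intro mult_left_mono) auto
  also have "\<dots> \<le> 8 * \<sigma> / (R^2 * X)" using \<eta>_bounds by simp
  also have "\<dots> \<le> 9 * \<sigma> / (R^2 * X^2)"
  proof (rule frac_le)
    show "R^2 * X^2 \<le> R^2 * X" using X_bounds by (intro mult_left_mono) (auto simp: power2_eq_square)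
  qed (use \<sigma>_nonneg X_bounds R_pos in auto)
  also have "\<dots> = (3 * sqrt \<sigma> / (R * X))^2" using \<sigma>_nonneg by (simp add: power_mult_distrib power_divide)
  finally show ?thesis using X_bounds R_pos \<sigma>_nonneg by (simp add: power2_le_iff_abs_le)
qed

end

section \<open>The drift and the solution\<close>

lemma norm_line:
  fixes x :: "real^'n"
  assumes "x \<noteq> 0"
  shows "((\<lambda>t. norm (x + t *\<^sub>R e\<^sub>i i)) has_real_derivative x $ i / norm x) (at 0)"
proof -
  have "(sqrt has_real_derivative inverse (sqrt ((norm x)^2)) / 2) (at ((norm x)^2))"
    using assms by (intro DERIV_real_sqrt) simp
  hence "(sqrt has_real_derivative inverse (norm x) / 2) (at ((norm (x + 0 *\<^sub>R e\<^sub>i i))^2))" by simp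
  from DERIV_chain2[where g = "\<lambda>t. (norm (x + t *\<^sub>R e\<^sub>i i))^2", OF this norm_sq_line]
  have "((\<lambda>t. norm (x + t *\<^sub>R e\<^sub>i i)) has_real_derivative inverse (norm x) / 2 * (2 * x $ i)) (at 0)"
    by (simp only: real_sqrt_abs abs_norm_cancel)
  thus ?thesis by (rule DERIV_cong) (simp add: field_simps)
qed

lemma norm_chain:
  fixes x :: "real^'n"
  assumes "x \<noteq> 0" "(f has_real_derivative D) (at (norm x))"
  shows "((\<lambda>t. f (norm (x + t *\<^sub>R e\<^sub>i i))) has_real_derivative D * (x $ i / norm x)) (at 0)"
proof -
  have "(f has_real_derivative D) (at (norm (x + 0 *\<^sub>R e\<^sub>i i)))" using assms(2) by simp
  from DERIV_chain2[where g = "\<lambda>t. norm (x + t *\<^sub>R e\<^sub>i i)", OF this norm_line[OF assms(1)]]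
  show ?thesis .
qed

lemma coord_line: "((\<lambda>t. (x + t *\<^sub>R e\<^sub>i i) $ l) has_real_derivative (if l = i then 1 else 0)) (at 0)"
  for x :: "real^'n"
  by (auto intro!: derivative_eq_intros simp: axis_def)

lemma integrable_half_ball:
  fixes F :: "'a::euclidean_space \<Rightarrow> 'b::{banach, second_countable_topology}" and \<beta> :: real
  assumes "0 \<le> \<beta>" "\<beta> < DIM('a)" and "F \<in> borel_measurable borel"
    and bnd: "AE x in lborel. norm x < 1/2 \<longrightarrow> norm (F x) \<le> C * norm x powr (-\<beta>)"
  shows "integrable lborel (\<lambda>x. indicator (ball 0 (1/2)) x *\<^sub>R F x)"
proof (rule integrable_power_singularity[OF assms(1,2), where C = "\<bar>C\<bar>"])
  show "(\<lambda>x. indicator (ball 0 (1/2)) x *\<^sub>R F x) \<in> borel_measurable borel"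
    using assms(3) by (intro borel_measurable_scaleR borel_measurable_indicator) auto
  show "AE x in lborel. norm x < 1 \<longrightarrow> norm (indicator (ball 0 (1/2)) x *\<^sub>R F x) \<le> \<bar>C\<bar> * norm x powr (-\<beta>)"
    using bnd
  proof eventually_elim
    case (elim x)
    have "C * norm x powr (-\<beta>) \<le> \<bar>C\<bar> * norm x powr (-\<beta>)" by (intro mult_right_mono) auto
    thus ?case using elim by (cases "norm x < 1/2") auto
  qed
qed simp

lemma borel_measurable_lebesgue_onI: "f \<in> borel_measurable borel \<Longrightarrow> f \<in> borel_measurable (lebesgue_on S)"
  by (intro measurable_restrict_space1 measurable_completion) simp

lemma locally_integrable_on_ball:
  fixes f :: "'a::euclidean_space \<Rightarrow> 'b::euclidean_space"
  assumes "integrable lborel (\<lambda>x. indicator (ball 0 r) x *\<^sub>R f x)"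
  shows "locally_integrable_on f (ball 0 r)"
  unfolding locally_integrable_on_def
proof (intro allI impI)
  fix K :: "'a set" assume K: "compact K \<and> K \<subseteq> ball 0 r"
  have "set_integrable lebesgue (ball 0 r) f"
    unfolding set_integrable_def using assms
    by (subst integrable_completion) auto
  thus "f absolutely_integrable_on K"
    by (rule set_integrable_subset) (use K in \<open>auto intro: lmeasurable_compact fmeasurableD\<close>)
qed

lemma has_bochner_integral_AE:
  assumes "has_bochner_integral N f I" "AE x in N. f x = g x" "g \<in> borel_measurable N"
  shows "has_bochner_integral N g I"
  using assms integrable_cong_AE[of f N g] integral_cong_AE[of f N g]
  by (auto simp: has_bochner_integral_iff)

lemma grad_eq_sum: "grad h = (\<lambda>x. \<Sum>i\<in>UNIV. pd i h x *\<^sub>R e\<^sub>i i)" for h :: "real^'n \<Rightarrow> real"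
  by (rule ext) (simp add: vec_eq_iff grad_nth axis_def if_distrib cong: if_cong)

lemma grad_measurable:
  fixes h :: "real^'n \<Rightarrow> real"
  assumes "h \<in> test_functions S"
  shows "grad h \<in> borel_measurable borel"
  unfolding grad_eq_sum using test_measurable[OF pd_test[OF assms]]
  by (intro borel_measurable_sum borel_measurable_scaleR) auto

lemma grad_zero:
  fixes h :: "real^'n \<Rightarrow> real"
  assumes "h \<in> test_functions S" "x \<notin> S" shows "grad h x = 0"
  using test_zero[OF pd_test[OF assms(1)] assms(2)] by (simp add: grad_eq_sum)

lemma grad_bounded:
  fixes h :: "real^'n \<Rightarrow> real"
  assumes "h \<in> test_functions S" shows "\<exists>B>0. \<forall>x. norm (grad h x) \<le> B"
proof -
  obtain b where b: "\<And>i x. \<bar>pd i h x\<bar> \<le> b i" using test_bounded[OF pd_test[OF assms]] by metis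
  have "norm (grad h x) \<le> (\<Sum>i\<in>UNIV. b i)" for x
    unfolding grad_eq_sum by (rule order.trans[OF norm_sum sum_mono]) (simp add: norm_axis_1 b)
  thus ?thesis by (intro exI[of _ "max 1 (\<Sum>i\<in>UNIV. b i)"]) (auto simp: le_max_iff_disj)
qed

section \<open>Derivatives of the stream function and of the radial factor\<close>

context profile
begin

lemma psi_chain:
  assumes q: "0 \<le> q" and R: "(R has_real_derivative R') (at 0)" "0 < R 0"
    and u: "(u has_real_derivative u') (at 0)"
  shows "((\<lambda>t. u t * (M (R t) - M (rs q ((u t)^2)))) has_real_derivative
    u' * (M (R 0) - M (rs q ((u 0)^2)))
      + u 0 * (m (R 0 powr d) * R' - 2 * u 0 * u' * L q ((u 0)^2))) (at 0)"
proof -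
  have 1: "((\<lambda>t. M (R t)) has_real_derivative m (R 0 powr d) * R') (at 0)"
    by (rule DERIV_chain2[OF M_deriv[OF R(2)] R(1)])
  have 2: "((\<lambda>t. (u t)^2) has_real_derivative 2 * u 0 * u') (at 0)"
    using DERIV_power[OF u, of 2] by (simp add: mult_ac)
  have 3: "((\<lambda>t. M (rs q ((u t)^2))) has_real_derivative L q ((u 0)^2) * (2 * u 0 * u')) (at 0)"
    by (rule DERIV_chain2[OF M_rs_deriv[OF q] 2])
  show ?thesis
    by (rule DERIV_cong[OF DERIV_mult[OF u DERIV_diff[OF 1 3]]]) (simp add: algebra_simps)
qed

definition \<phi>1 :: "real \<Rightarrow> real" where
  "\<phi>1 R = (3 + (1 - d) * (3 - d) * R powr d) / R^4"

lemma \<phi>_deriv: assumes "0 < R" shows "(\<phi> has_real_derivative \<phi>1 R) (at R)"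
proof -
  have n: "((\<lambda>R. - (1 + (1 - d) * R powr d)) has_real_derivative - ((1 - d) * (d * R powr d / R))) (at R)"
    by (rule DERIV_cong[OF DERIV_minus[OF DERIV_add[OF DERIV_const DERIV_cmult[OF powr_deriv[OF assms]]]]]) simp
  have c: "((\<lambda>R. R^3) has_real_derivative 3 * R^2) (at R)"
    by (auto intro!: derivative_eq_intros)
  have "(\<phi> has_real_derivative
      (- ((1 - d) * (d * R powr d / R)) * R^3 - - (1 + (1 - d) * R powr d) * (3 * R^2)) / (R^3 * R^3)) (at R)"
    unfolding \<phi>_def using assms by (intro DERIV_divide n c) auto
  also have "(- ((1 - d) * (d * R powr d / R)) * R^3 - - (1 + (1 - d) * R powr d) * (3 * R^2)) / (R^3 * R^3) = \<phi>1 R"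
    unfolding \<phi>1_def using assms by (simp add: divide_simps) (simp add: algebra_simps eval_nat_numeral)
  finally show ?thesis .
qed

lemma radial_factor_deriv: assumes "0 < R"
  shows "((\<lambda>R. (1 + R powr d) / R) has_real_derivative R * \<phi> R) (at R)"
proof -
  have n: "((\<lambda>R. 1 + R powr d) has_real_derivative d * R powr d / R) (at R)"
    by (rule DERIV_cong[OF DERIV_add[OF DERIV_const powr_deriv[OF assms]]]) simp
  have "((\<lambda>R. (1 + R powr d) / R) has_real_derivative
      (d * R powr d / R * R - (1 + R powr d) * 1) / (R * R)) (at R)"
    using assms by (intro DERIV_divide n DERIV_ident) auto
  also have "(d * R powr d / R * R - (1 + R powr d) * 1) / (R * R) = R * \<phi> R"
    unfolding \<phi>_def using assms by (simp add: divide_simps) (simp add: algebra_simps power3_eq_cube)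
  finally show ?thesis .
qed

text \<open>For the radial factor \<open>f\<close> of \<open>u\<close>, the left-hand side is
  \<open>f'' + (\<nu> + 1) * f' / R\<close>, that is, the Laplacian of \<open>z * f\<close> divided
  by \<open>z\<close> in dimension \<open>\<nu>\<close>. This identity dictates the choice of
  \<open>m\<close>.\<close>

lemma laplace_eq: assumes "0 < R"
  shows "(\<nu> + 2) * \<phi> R + R * \<phi>1 R = m (R powr d) * (1 + R powr d)^2 / R^3"
proof -
  have "m (R powr d) * (1 + R powr d)^2 = - ((\<nu> - 1) + (1 - d) * (\<nu> - 1 + d) * R powr d)"
  proof -
    have "1 + R powr d \<noteq> 0" by (smt (verit) powr_ge_zero)
    thus ?thesis by (simp add: m_def)
  qed
  moreover have "(\<nu> + 2) * \<phi> R + R * \<phi>1 R = - ((\<nu> - 1) + (1 - d) * (\<nu> - 1 + d) * R powr d) / R^3"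
    unfolding \<phi>_def \<phi>1_def using assms
    by (simp add: divide_simps power3_eq_cube power4_eq_xxxx) (simp add: algebra_simps)
  ultimately show ?thesis by simp
qed

lemma \<phi>_measurable [measurable]: "\<phi> \<in> borel_measurable borel"
  unfolding \<phi>_def[abs_def] by measurable

lemma \<phi>1_measurable [measurable]: "\<phi>1 \<in> borel_measurable borel"
  unfolding \<phi>1_def[abs_def] by measurable

lemma m_measurable [measurable]: "m \<in> borel_measurable borel"
  unfolding m_def[abs_def] by measurable

lemma \<phi>_bound: assumes "0 < R" "R \<le> 1" shows "\<bar>\<phi> R\<bar> \<le> 2 / R^3"
proof -
  have "R powr d \<le> 1" using assms d_pos by (simp add: powr_le1)
  hence "(1 - d) * R powr d \<le> 1" using d_pos d_le by (intro mult_le_one) auto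
  moreover have "0 \<le> (1 - d) * R powr d" using d_le by simp
  ultimately have "\<bar>- (1 + (1 - d) * R powr d)\<bar> \<le> 2" by linarith
  hence "\<bar>- (1 + (1 - d) * R powr d)\<bar> / R^3 \<le> 2 / R^3"
    using assms by (intro divide_right_mono) auto
  thus ?thesis unfolding \<phi>_def using assms by simp
qed

lemma \<phi>1_bound: assumes "0 < R" "R \<le> 1" shows "\<bar>\<phi>1 R\<bar> \<le> 6 / R^4"
proof -
  have X: "R powr d \<le> 1" using assms d_pos by (simp add: powr_le1)
  have "(1 - d) * (3 - d) \<le> 1 * 3" using d_pos d_le by (intro mult_mono) auto
  hence "(1 - d) * (3 - d) * R powr d \<le> 3 * 1" using X d_le by (intro mult_mono) auto
  moreover have "0 \<le> (1 - d) * (3 - d) * R powr d" using d_le by simp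
  ultimately have "\<bar>3 + (1 - d) * (3 - d) * R powr d\<bar> \<le> 6" by linarith
  hence "\<bar>3 + (1 - d) * (3 - d) * R powr d\<bar> / R^4 \<le> 6 / R^4"
    using assms by (intro divide_right_mono) auto
  thus ?thesis unfolding \<phi>1_def using assms by simp
qed

end

section \<open>The drift, its potential and the pointwise equation\<close>

locale drift = profile d \<nu> for d \<nu> +
  fixes k i1 i2 :: "'n::finite"
  assumes distinct: "k \<noteq> i1" "k \<noteq> i2" "i1 \<noteq> i2" and \<nu>_card: "\<nu> = real CARD('n)"
begin

lemma card_ge: "3 \<le> CARD('n)"
  using nu_ge unfolding \<nu>_card by simp

definition sg :: "real^'n \<Rightarrow> real" where "sg x = (x $ i1)^2 + (x $ i2)^2"
definition qq :: "real^'n \<Rightarrow> real" where "qq x = (norm x)^2 - (x $ k)^2 - sg x"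
definition uu :: "real^'n \<Rightarrow> real" where "uu x = U (norm x) (x $ k)"
definition psi :: "real^'n \<Rightarrow> real" where "psi x = \<psi> (norm x) (x $ k) (qq x)"
definition bz :: "real^'n \<Rightarrow> real" where "bz x = Psig (norm x) (x $ k) (qq x)"
definition br :: "real^'n \<Rightarrow> real" where "br x = Pz (norm x) (x $ k) (qq x) / sg x"
text \<open>With \<open>\<rho> = sqrt \<sigma>\<close> these are the Stokes formulas: component
  \<open>\<psi>_\<rho> / \<rho>\<close> along the axis and \<open>- \<psi>_z / \<rho>\<close> in the
  radial direction of the plane of \<open>i1\<close> and \<open>i2\<close>.\<close>

definition bb :: "real^'n \<Rightarrow> real^'n" where
  "bb x = bz x *\<^sub>R e\<^sub>i k - br x *\<^sub>R (x $ i1 *\<^sub>R e\<^sub>i i1 + x $ i2 *\<^sub>R e\<^sub>i i2)"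
definition gu :: "real^'n \<Rightarrow> real^'n" where
  "gu x = ((1 + norm x powr d) / norm x) *\<^sub>R e\<^sub>i k + (x $ k * \<phi> (norm x)) *\<^sub>R x"
definition D2 :: "'n \<Rightarrow> real^'n \<Rightarrow> real" where
  "D2 i x = (if i = k then 2 * x $ k * \<phi> (norm x) else 0)
     + x $ k * \<phi> (norm x) + x $ k * (x $ i)^2 * \<phi>1 (norm x) / norm x"

lemma sg_nonneg: "0 \<le> sg x" by (simp add: sg_def)

lemma sg_pos: "x $ j \<noteq> 0 \<Longrightarrow> j = i1 \<or> j = i2 \<Longrightarrow> 0 < sg x"
  by (auto simp: sg_def sum_power2_gt_zero_iff)

lemma norm_sq_sum: "(norm x)^2 = (\<Sum>i\<in>UNIV. (x $ i)^2)" for x :: "real^'n"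
  unfolding power2_norm_eq_inner inner_cart by (simp add: power2_eq_square)

lemma qq_nonneg: "0 \<le> qq x"
proof -
  have "(\<Sum>i\<in>{k, i1, i2}. (x $ i)^2) \<le> (norm x)^2"
    unfolding norm_sq_sum by (intro sum_mono2) auto
  thus ?thesis using distinct by (simp add: qq_def sg_def)
qed

lemma point: assumes "x \<noteq> 0" "norm x \<le> 1"
  shows "profile_point d \<nu> (norm x) (x $ k) (qq x) (sg x)"
  using assms qq_nonneg sg_nonneg by unfold_locales (auto simp: qq_def)

lemma measurables [measurable]:
  "sg \<in> borel_measurable borel" "qq \<in> borel_measurable borel" "uu \<in> borel_measurable borel"
  "psi \<in> borel_measurable borel" "bz \<in> borel_measurable borel" "br \<in> borel_measurable borel"
  "bb \<in> borel_measurable borel" "gu \<in> borel_measurable borel" "D2 i \<in> borel_measurable borel"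
proof -
  show [measurable]: "sg \<in> borel_measurable borel" unfolding sg_def[abs_def] by measurable
  show [measurable]: "qq \<in> borel_measurable borel" unfolding qq_def[abs_def] by measurable
  have U [measurable]: "(\<lambda>x::real^'n. U (norm x) (x $ k)) \<in> borel_measurable borel" unfolding U_def by measurable
  have [measurable]: "(\<lambda>x::real^'n. Uz (norm x) (x $ k)) \<in> borel_measurable borel" unfolding Uz_def by measurable
  show "uu \<in> borel_measurable borel" unfolding uu_def[abs_def] by measurable
  have rs: "(\<lambda>x. rs (qq x) ((U (norm x) (x $ k))^2)) \<in> borel_measurable borel"
    by (rule rs_measurable) (measurable, rule qq_nonneg)
  note [measurable] = rs
  have [measurable]: "(\<lambda>x. L (qq x) ((U (norm x) (x $ k))^2)) \<in> borel_measurable borel"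
    unfolding L_def E_def by measurable
  show "psi \<in> borel_measurable borel" unfolding psi_def[abs_def] \<psi>_def by measurable
  show [measurable]: "bz \<in> borel_measurable borel" unfolding bz_def[abs_def] Psig_def by measurable
  show [measurable]: "br \<in> borel_measurable borel" unfolding br_def[abs_def] Pz_def by measurable
  show "bb \<in> borel_measurable borel" unfolding bb_def[abs_def] by measurable
  show "gu \<in> borel_measurable borel" unfolding gu_def[abs_def]
    by (intro borel_measurable_add borel_measurable_scaleR) measurable
  show "D2 i \<in> borel_measurable borel" unfolding D2_def[abs_def] by (cases "i = k"; simp; measurable)
qed

lemma gu_nth: "gu x $ i = (if i = k then (1 + norm x powr d) / norm x else 0) + x $ k * \<phi> (norm x) * x $ i"
  by (simp add: gu_def axis_def)

lemma uu_line: assumes "x \<noteq> 0"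
  shows "((\<lambda>t. uu (x + t *\<^sub>R e\<^sub>i i)) has_real_derivative gu x $ i) (at 0)"
proof -
  have R: "0 < norm x" using assms by simp
  have "((\<lambda>t. (1 + norm (x + t *\<^sub>R e\<^sub>i i) powr d) / norm (x + t *\<^sub>R e\<^sub>i i))
      has_real_derivative norm x * \<phi> (norm x) * (x $ i / norm x)) (at 0)"
    by (rule norm_chain[OF assms radial_factor_deriv[OF R]])
  from DERIV_mult[OF coord_line[of x i k] this]
  have "((\<lambda>t. (x + t *\<^sub>R e\<^sub>i i) $ k * ((1 + norm (x + t *\<^sub>R e\<^sub>i i) powr d) / norm (x + t *\<^sub>R e\<^sub>i i)))
      has_real_derivative gu x $ i) (at 0)"
    by (rule DERIV_cong) (use R in \<open>auto simp: gu_nth\<close>)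
  thus ?thesis by (simp add: uu_def U_def)
qed

lemma gu_line: assumes "x \<noteq> 0"
  shows "((\<lambda>t. gu (x + t *\<^sub>R e\<^sub>i i) $ i) has_real_derivative D2 i x) (at 0)"
proof -
  have R: "0 < norm x" using assms by simp
  have 1: "((\<lambda>t. (1 + norm (x + t *\<^sub>R e\<^sub>i i) powr d) / norm (x + t *\<^sub>R e\<^sub>i i))
      has_real_derivative norm x * \<phi> (norm x) * (x $ i / norm x)) (at 0)"
    by (rule norm_chain[OF assms radial_factor_deriv[OF R]])
  hence 1: "((\<lambda>t. if i = k then (1 + norm (x + t *\<^sub>R e\<^sub>i i) powr d) / norm (x + t *\<^sub>R e\<^sub>i i) else 0)
      has_real_derivative (if i = k then \<phi> (norm x) * x $ i else 0)) (at 0)"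
    using R by (auto simp: field_simps)
  have 2: "((\<lambda>t. \<phi> (norm (x + t *\<^sub>R e\<^sub>i i))) has_real_derivative \<phi>1 (norm x) * (x $ i / norm x)) (at 0)"
    by (rule norm_chain[OF assms \<phi>_deriv[OF R]])
  show ?thesis unfolding gu_nth
    by (rule DERIV_cong[OF DERIV_add[OF 1 DERIV_mult[OF DERIV_mult[OF coord_line[of x i k] 2] coord_line[of x i i]]]])
      (auto simp: D2_def algebra_simps power2_eq_square)
qed

lemma psi_eq: "psi x = uu x * (M (norm x) - M (rs (qq x) ((uu x)^2)))"
  by (simp add: psi_def \<psi>_def uu_def)

lemma psi_line_gen: assumes "x \<noteq> 0" and q: "\<And>t. qq (x + t *\<^sub>R e\<^sub>i i) = qq x"
  shows "((\<lambda>t. psi (x + t *\<^sub>R e\<^sub>i i)) has_real_derivative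
    gu x $ i * (M (norm x) - M (rs (qq x) ((uu x)^2)))
      + uu x * (m (norm x powr d) * (x $ i / norm x) - 2 * uu x * gu x $ i * L (qq x) ((uu x)^2))) (at 0)"
proof -
  have eq: "psi (x + t *\<^sub>R e\<^sub>i i) = uu (x + t *\<^sub>R e\<^sub>i i)
      * (M (norm (x + t *\<^sub>R e\<^sub>i i)) - M (rs (qq x) ((uu (x + t *\<^sub>R e\<^sub>i i))^2)))" for t
    by (simp only: psi_eq q)
  have "0 < norm (x + 0 *\<^sub>R e\<^sub>i i)" using assms(1) by simp
  from psi_chain[where R = "\<lambda>t. norm (x + t *\<^sub>R e\<^sub>i i)" and u = "\<lambda>t. uu (x + t *\<^sub>R e\<^sub>i i)" and q = "qq x",
      OF qq_nonneg norm_line[OF assms(1)] this uu_line[OF assms(1)]]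
  show ?thesis unfolding eq by (simp only: scaleR_zero_left add_0_right)
qed

text \<open>The value \<open>qq x\<close> is the sum of the squares of the coordinates other than
  \<open>k\<close>, \<open>i1\<close> and \<open>i2\<close>.\<close>

lemma qq_const: assumes "i = k \<or> i = i1 \<or> i = i2" shows "qq (x + t *\<^sub>R e\<^sub>i i) = qq x"
  unfolding qq_def norm_sq_add using assms distinct
  by (auto simp: sg_def axis_def power2_sum algebra_simps)

lemma psi_line_k: assumes "x \<noteq> 0"
  shows "((\<lambda>t. psi (x + t *\<^sub>R e\<^sub>i k)) has_real_derivative Pz (norm x) (x $ k) (qq x)) (at 0)"
proof -
  have "gu x $ k = Uz (norm x) (x $ k)" by (simp add: gu_nth Uz_def power2_eq_square)
  moreover have "qq (x + t *\<^sub>R e\<^sub>i k) = qq x" for t by (rule qq_const) simp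
  from psi_line_gen[OF assms this] have "((\<lambda>t. psi (x + t *\<^sub>R e\<^sub>i k)) has_real_derivative
    gu x $ k * (M (norm x) - M (rs (qq x) ((uu x)^2)))
      + uu x * (m (norm x powr d) * (x $ k / norm x) - 2 * uu x * gu x $ k * L (qq x) ((uu x)^2))) (at 0)" .
  ultimately show ?thesis by (simp only: Pz_def uu_def times_divide_eq_right)
qed

lemma psi_line_i: assumes "x \<noteq> 0" "i = i1 \<or> i = i2"
  shows "((\<lambda>t. psi (x + t *\<^sub>R e\<^sub>i i)) has_real_derivative x $ i * bz x) (at 0)"
proof -
  have "i \<noteq> k" using assms distinct by auto
  hence g: "gu x $ i = x $ k * \<phi> (norm x) * x $ i" by (simp add: gu_nth)
  have "qq (x + t *\<^sub>R e\<^sub>i i) = qq x" for t by (rule qq_const) (use assms in blast)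
  from psi_line_gen[OF assms(1) this] show ?thesis
    by (rule DERIV_cong) (simp add: g bz_def Psig_def uu_def algebra_simps)
qed

text \<open>\<open>G i\<close> is the entry \<open>(k, i)\<close> of the skew-symmetric potential of \<open>bb\<close>.\<close>

definition G :: "'n \<Rightarrow> real^'n \<Rightarrow> real" where "G i x = x $ i * psi x / sg x"
definition G' :: "'n \<Rightarrow> real^'n \<Rightarrow> real" where
  "G' i x = psi x / sg x * (1 - 2 * (x $ i)^2 / sg x) + (x $ i)^2 / sg x * bz x"

lemma G_measurable [measurable]: "G i \<in> borel_measurable borel" "G' i \<in> borel_measurable borel"
  unfolding G_def[abs_def] G'_def[abs_def] by measurable

lemma G_line: assumes "i = i1 \<or> i = i2" "0 < sg x"
  shows "((\<lambda>t. G i (x + t *\<^sub>R e\<^sub>i i)) has_real_derivative G' i x) (at 0)"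
proof -
  have x: "x \<noteq> 0" using assms by (auto simp: sg_def)
  have s: "((\<lambda>t. sg (x + t *\<^sub>R e\<^sub>i i)) has_real_derivative 2 * x $ i) (at 0)"
    unfolding sg_def using assms distinct
    by (auto intro!: derivative_eq_intros simp: axis_def)
  have n: "((\<lambda>t. (x + t *\<^sub>R e\<^sub>i i) $ i * psi (x + t *\<^sub>R e\<^sub>i i)) has_real_derivative psi x + x $ i * (x $ i * bz x)) (at 0)"
    using DERIV_mult[OF coord_line[of x i i] psi_line_i[OF x assms(1)]]
    by (rule DERIV_cong) (simp add: algebra_simps)
  show ?thesis unfolding G_def
    using assms(2)
    by (intro DERIV_cong[OF DERIV_divide[OF n s]])
      (auto simp: G'_def field_simps power2_eq_square)
qed

lemma G_line_k: assumes "i = i1 \<or> i = i2" "0 < sg x"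
  shows "((\<lambda>t. G i (x + t *\<^sub>R e\<^sub>i k)) has_real_derivative x $ i * br x) (at 0)"
proof -
  have x: "x \<noteq> 0" using assms by (auto simp: sg_def)
  have s: "sg (x + t *\<^sub>R e\<^sub>i k) = sg x" "(x + t *\<^sub>R e\<^sub>i k) $ i = x $ i" for t
    using assms distinct by (auto simp: sg_def axis_def)
  show ?thesis unfolding G_def s
    using DERIV_cdivide[OF DERIV_cmult[OF psi_line_k[OF x]], of "x $ i" "sg x"] by (simp add: br_def)
qed

text \<open>Off the axis the planar field \<open>x / \<sigma>\<close> is divergence free, so only
  the derivatives of \<open>psi\<close> survive.\<close>

lemma G'_sum: assumes "0 < sg x" shows "G' i1 x + G' i2 x = bz x"
proof -
  have "G' i1 x + G' i2 x = psi x / sg x * (2 - 2 * ((x $ i1)^2 / sg x + (x $ i2)^2 / sg x))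
      + ((x $ i1)^2 / sg x + (x $ i2)^2 / sg x) * bz x"
    by (simp add: G'_def algebra_simps add_divide_distrib)
  moreover have "(x $ i1)^2 / sg x + (x $ i2)^2 / sg x = sg x / sg x"
    by (simp only: sg_def add_divide_distrib)
  hence "(x $ i1)^2 / sg x + (x $ i2)^2 / sg x = 1" using assms by simp
  ultimately show ?thesis by simp
qed

text \<open>A quarter of it, \<open>20 * \<nu> / d\<close>, is the constant of
  \<open>Psig_bound\<close>; three quarters, \<open>60 * \<nu> / d\<close>, cover the
  \<open>57 = 19 * 3\<close> arising from \<open>Pz_bound\<close> and
  \<open>\<eta>_\<sigma>\<close>.\<close>

definition "C0 = 80 * \<nu> / d"

lemma C0_pos: "0 < C0" using nu_ge d_pos by (simp add: C0_def)

lemma potential_bounds: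
  assumes "norm x \<le> 1" "0 < sg x" "i = i1 \<or> i = i2"
  shows "\<bar>bz x\<bar> \<le> C0 / 4 / (norm x * norm x powr d)"
    and "sqrt (sg x) * \<bar>br x\<bar> \<le> 3 / 4 * C0 / (norm x * norm x powr d)"
    and "\<bar>x $ i * br x\<bar> \<le> C0 / (norm x)^2"
    and "\<bar>G i x\<bar> \<le> C0 / norm x"
    and "\<bar>G' i x\<bar> \<le> C0 / (norm x)^2"
proof -
  have x: "x \<noteq> 0" using assms by (auto simp: sg_def)
  interpret profile_point d \<nu> "norm x" "x $ k" "qq x" "sg x" by (rule point[OF x assms(1)])
  let ?R = "norm x" and ?s = "sqrt (sg x)"
  have s: "0 < ?s" "?s * ?s = sg x" using assms by auto
  have RX: "0 < ?R * X" using R_pos X_bounds by simp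
  \<comment> \<open>This trades the sharp rate \<open>1 / (R * X)\<close> for the cruder
    \<open>1 / R^2\<close> accepted by integration by parts.\<close>
  have XR: "?R \<le> X" using powr_mono'[of d 1 ?R] d_le R_le powr_one[of ?R] by simp
  have nd: "0 \<le> \<nu> / d" using nu_ge d_pos by simp
  have RX2: "c / (?R * X) \<le> c / ?R^2" if "0 \<le> c" for c
    unfolding power2_eq_square using that R_pos XR X_bounds by (intro divide_left_mono mult_left_mono) auto
  have cancel: "c * (a * (3 * c / b) / g) = 3 * a / b" "c * (a * (3 * c / b)) / g = 3 * a / b"
    if "c \<noteq> 0" "c * c = g" for a b c g :: real
    using that(1) unfolding that(2)[symmetric] by simp_all
  show b1: "\<bar>bz x\<bar> \<le> C0 / 4 / (?R * X)"
    using Psig_bound by (simp add: bz_def C0_def)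
  have "\<bar>Pz ?R (x $ k) (qq x)\<bar> \<le> 19 * \<nu> / d * (3 * ?s / (?R * X))"
    using Pz_bound mult_left_mono[OF \<eta>_\<sigma>, of "19 * \<nu> / d"] nd by simp
  hence "?s * \<bar>br x\<bar> \<le> ?s * (19 * \<nu> / d * (3 * ?s / (?R * X)) / sg x)"
    unfolding br_def abs_divide abs_of_pos[OF assms(2)]
    using s assms(2) by (intro mult_left_mono divide_right_mono) auto
  also have "\<dots> = 57 * (\<nu> / d) / (?R * X)"
    using cancel[OF _ s(2), of "19 * \<nu> / d" "?R * X"] s(1) by simp
  also have "\<dots> \<le> 3 / 4 * C0 / (?R * X)"
    using RX nd by (intro divide_right_mono) (auto simp: C0_def)
  finally show b2: "?s * \<bar>br x\<bar> \<le> 3 / 4 * C0 / (?R * X)" .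
  have xi: "\<bar>x $ i\<bar> \<le> ?s" using assms(3) by (auto simp: sg_def real_le_rsqrt)
  have "\<bar>x $ i * br x\<bar> \<le> ?s * \<bar>br x\<bar>" unfolding abs_mult using xi by (intro mult_right_mono) auto
  also have "\<dots> \<le> C0 / (?R * X)" using RX C0_pos
    by (intro order.trans[OF b2 divide_right_mono]) auto
  also have "\<dots> \<le> C0 / ?R^2" using C0_pos by (intro RX2) simp
  finally show "\<bar>x $ i * br x\<bar> \<le> C0 / ?R^2" .
  have p1: "\<bar>psi x\<bar> \<le> 2 * \<nu> / d * ?R * \<eta>" unfolding psi_def by (rule \<psi>_bound)
  have "\<bar>G i x\<bar> \<le> ?s * (2 * \<nu> / d * ?R * (3 * ?s / (?R * X))) / sg x"
  proof -
    have "0 \<le> 2 * \<nu> / d * ?R" using nu_ge d_pos R_pos by simp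
    from order.trans[OF p1 mult_left_mono[OF \<eta>_\<sigma> this]] xi s(1) assms(2) show ?thesis
      unfolding G_def abs_divide abs_mult abs_of_pos[OF assms(2)]
      by (intro divide_right_mono mult_mono) auto
  qed
  also have "\<dots> = 6 * (\<nu> / d) / X"
    using cancel[OF _ s(2), of "2 * \<nu> / d * ?R" "?R * X"] s(1) R_pos by simp
  also have "\<dots> \<le> C0 / ?R"
    using XR R_pos X_bounds nd by (intro frac_le) (auto simp: C0_def)
  finally show "\<bar>G i x\<bar> \<le> C0 / ?R" .
  have "\<bar>psi x\<bar> / sg x \<le> 2 * \<nu> / d * ?R * (8 * sg x / (?R^2 * X)) / sg x"
  proof -
    have "0 \<le> 2 * \<nu> / d * ?R" using nu_ge d_pos R_pos by simp
    from order.trans[OF p1 mult_left_mono[OF \<eta>_bounds(3) this]] show ?thesis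
      using assms(2) by (intro divide_right_mono) auto
  qed
  also have "\<dots> = 16 * (\<nu> / d) / (?R * X)"
    using assms(2) R_pos by (simp add: power2_eq_square)
  finally have p2: "\<bar>psi x / sg x\<bar> \<le> 16 * (\<nu> / d) / (?R * X)" using assms(2) by simp
  have w: "0 \<le> (x $ i)^2 / sg x" "(x $ i)^2 / sg x \<le> 1"
    using assms(2,3) by (auto simp: sg_def divide_le_eq)
  have w1: "\<bar>1 - 2 * (x $ i)^2 / sg x\<bar> \<le> 1" using w by (simp add: abs_le_iff)
  have "0 \<le> 16 * (\<nu> / d) / (?R * X)" using nu_ge d_pos RX by (intro divide_nonneg_pos mult_nonneg_nonneg) auto
  from mult_mono[OF p2 w1 this abs_ge_zero]
  have "\<bar>psi x / sg x * (1 - 2 * (x $ i)^2 / sg x)\<bar> \<le> 16 * (\<nu> / d) / (?R * X) * 1"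
    unfolding abs_mult[of "psi x / sg x"] .
  moreover have "\<bar>(x $ i)^2 / sg x * bz x\<bar> \<le> 1 * (C0 / 4 / (?R * X))"
    unfolding abs_mult[of "(x $ i)^2 / sg x"] using b1 w by (intro mult_mono) auto
  ultimately have "\<bar>G' i x\<bar> \<le> 16 * (\<nu> / d) / (?R * X) * 1 + 1 * (C0 / 4 / (?R * X))"
    unfolding G'_def by (rule order.trans[OF abs_triangle_ineq add_mono])
  also have "\<dots> = 36 * (\<nu> / d) / (?R * X)" by (simp add: C0_def flip: add_divide_distrib)
  also have "\<dots> \<le> C0 / (?R * X)" using nd RX by (intro divide_right_mono) (auto simp: C0_def)
  also have "\<dots> \<le> C0 / ?R^2" using C0_pos by (intro RX2) simp
  finally show "\<bar>G' i x\<bar> \<le> C0 / ?R^2" .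
qed

lemma bb_bound: assumes "norm x \<le> 1" "0 < sg x"
  shows "norm (bb x) \<le> C0 * norm x powr (- (1 + d))"
proof -
  have x: "0 < norm x" using assms by (auto simp: sg_def)
  have "norm (x $ i1 *\<^sub>R e\<^sub>i i1 + x $ i2 *\<^sub>R e\<^sub>i i2 :: real^'n) = sqrt (sg x)"
    unfolding norm_eq_sqrt_inner using distinct
    by (simp add: inner_add_left inner_add_right inner_axis_axis sg_def power2_eq_square)
  moreover have "norm (bb x) \<le> norm (bz x *\<^sub>R e\<^sub>i k :: real^'n) + norm (br x *\<^sub>R (x $ i1 *\<^sub>R e\<^sub>i i1 + x $ i2 *\<^sub>R e\<^sub>i i2) :: real^'n)"
    unfolding bb_def by (rule norm_triangle_ineq4)
  ultimately have "norm (bb x) \<le> \<bar>bz x\<bar> + sqrt (sg x) * \<bar>br x\<bar>"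
    by (simp add: norm_axis_1 mult.commute)
  also have "\<dots> \<le> C0 / 4 / (norm x * norm x powr d) + 3 / 4 * C0 / (norm x * norm x powr d)"
    using potential_bounds[OF assms, of i1] by (intro add_mono) auto
  also have "\<dots> = C0 / (norm x * norm x powr d)" by (simp flip: add_divide_distrib)
  also have "\<dots> = C0 * norm x powr (- (1 + d))"
    using x by (simp only: powr_minus[of "norm x" "1 + d"] powr_add[of "norm x" 1 d] divide_inverse powr_one)
  finally show ?thesis .
qed

lemma gu_bound: assumes "x \<noteq> 0" "norm x \<le> 1" shows "norm (gu x) \<le> 4 / norm x"
proof -
  have x: "0 < norm x" using assms by simp
  have X: "norm x powr d \<le> 1" using assms d_pos by (simp add: powr_le1)
  have "\<bar>x $ k * \<phi> (norm x)\<bar> \<le> norm x * (2 / norm x^3)"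
    unfolding abs_mult using \<phi>_bound[OF x assms(2)] component_le_norm_cart[of x k] by (intro mult_mono) auto
  hence "\<bar>x $ k * \<phi> (norm x)\<bar> * norm x \<le> norm x * (2 / norm x^3) * norm x"
    by (intro mult_right_mono) auto
  moreover have "norm x * (2 / norm x^3) * norm x = 2 / norm x"
    using x by (simp add: power3_eq_cube)
  moreover have "(1 + norm x powr d) / norm x \<le> 2 / norm x"
    using X x by (intro divide_right_mono) auto
  moreover have "norm (gu x) \<le> (1 + norm x powr d) / norm x + \<bar>x $ k * \<phi> (norm x)\<bar> * norm x"
    unfolding gu_def by (rule norm_triangle_le) (simp add: norm_axis_1)
  moreover have "4 / norm x = 2 / norm x + 2 / norm x" by simp
  ultimately show ?thesis by linarith
qed

lemma D2_bound: assumes "x \<noteq> 0" "norm x \<le> 1" shows "\<bar>D2 i x\<bar> \<le> 12 / (norm x)^2"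
proof -
  have x: "0 < norm x" using assms by simp
  have "\<bar>x $ k * \<phi> (norm x)\<bar> \<le> norm x * (2 / norm x^3)"
    unfolding abs_mult using \<phi>_bound[OF x assms(2)] component_le_norm_cart[of x k] by (intro mult_mono) auto
  also have "\<dots> = 2 / (norm x)^2" using x by (simp add: power3_eq_cube power2_eq_square)
  finally have 1: "\<bar>x $ k * \<phi> (norm x)\<bar> \<le> 2 / (norm x)^2" .
  have "\<bar>x $ k * (x $ i)^2 * \<phi>1 (norm x) / norm x\<bar> \<le> norm x * (norm x)^2 * (6 / norm x^4) / norm x"
  proof -
    have "\<bar>(x $ i)^2\<bar> \<le> (norm x)^2"
      using power_mono[OF component_le_norm_cart[of x i] abs_ge_zero, of 2] by simp
    thus ?thesis unfolding abs_divide abs_mult[of "x $ k * (x $ i)^2"] abs_mult[of "x $ k"] abs_norm_cancel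
      using \<phi>1_bound[OF x assms(2)] component_le_norm_cart[of x k] x
      by (intro divide_right_mono mult_mono) auto
  qed
  also have "\<dots> = 6 / (norm x)^2" using x by (simp add: power4_eq_xxxx power2_eq_square)
  finally have 2: "\<bar>x $ k * (x $ i)^2 * \<phi>1 (norm x) / norm x\<bar> \<le> 6 / (norm x)^2" .
  have 3: "\<bar>if i = k then 2 * x $ k * \<phi> (norm x) else 0\<bar> \<le> 4 / (norm x)^2"
    using mult_left_mono[OF 1, of 2] by (simp add: abs_mult)
  have "\<bar>D2 i x\<bar> \<le> 4 / (norm x)^2 + 2 / (norm x)^2 + 6 / (norm x)^2"
    unfolding D2_def by (rule abs_add3[OF 3 1 2])
  also have "\<dots> = 12 / (norm x)^2" by simp
  finally show ?thesis .
qed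

lemma uu_bound: "norm x \<le> 1 \<Longrightarrow> \<bar>uu x\<bar> \<le> 2"
  using profile_point.U_bound[OF point, of x] by (cases "x = 0") (auto simp: uu_def U_def)

text \<open>The terms of \<open>Psig\<close> and \<open>Pz\<close> proportional to the derivatives
  of \<open>u\<close> cancel, among them everything that stems from \<open>M \<circ> rs\<close>.
  Only the terms with \<open>m\<close> remain, and \<open>laplace_eq\<close> identifies them with
  the Laplacian.\<close>

lemma inner_gu_bb: assumes "0 < sg x" shows "gu x \<bullet> bb x = (\<Sum>i\<in>UNIV. D2 i x)"
proof -
  have R: "0 < norm x" using assms by (auto simp: sg_def)
  let ?R = "norm x" and ?z = "x $ k"
  have "gu x \<bullet> bb x = bz x * gu x $ k - br x * (x $ i1 * gu x $ i1 + x $ i2 * gu x $ i2)"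
    by (simp add: bb_def inner_diff_right inner_add_right inner_axis algebra_simps)
  also have "x $ i1 * gu x $ i1 + x $ i2 * gu x $ i2 = ?z * \<phi> ?R * sg x"
    using distinct by (simp add: gu_nth sg_def power2_eq_square algebra_simps)
  also have "br x * (?z * \<phi> ?R * sg x) = Pz ?R ?z (qq x) * (?z * \<phi> ?R)"
    using assms by (simp add: br_def)
  also have "gu x $ k = Uz ?R ?z" by (simp add: gu_nth Uz_def power2_eq_square)
  also have "bz x * Uz ?R ?z - Pz ?R ?z (qq x) * (?z * \<phi> ?R)
      = uu x * m (?R powr d) * (Uz ?R ?z - ?z * ?z * \<phi> ?R) / ?R"
    using R by (simp add: bz_def Psig_def Pz_def uu_def algebra_simps diff_divide_distrib)
  also have "Uz ?R ?z - ?z * ?z * \<phi> ?R = (1 + ?R powr d) / ?R" by (simp add: Uz_def power2_eq_square)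
  also have "uu x * m (?R powr d) * ((1 + ?R powr d) / ?R) / ?R = ?z * (m (?R powr d) * (1 + ?R powr d)^2 / ?R^3)"
    by (simp add: uu_def U_def power2_eq_square power3_eq_cube)
  also have "\<dots> = ?z * ((\<nu> + 2) * \<phi> ?R + ?R * \<phi>1 ?R)" using laplace_eq[OF R] by simp
  also have "\<dots> = (\<Sum>i\<in>UNIV. D2 i x)"
  proof -
    have "(\<Sum>i\<in>UNIV. D2 i x) = 2 * ?z * \<phi> ?R + \<nu> * (?z * \<phi> ?R) + (\<Sum>i\<in>UNIV. ?z * \<phi>1 ?R / ?R * (x $ i)^2)"
      unfolding D2_def sum.distrib by (simp add: \<nu>_card mult_ac)
    also have "(\<Sum>i\<in>UNIV. ?z * \<phi>1 ?R / ?R * (x $ i)^2) = ?z * \<phi>1 ?R / ?R * ?R^2"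
      unfolding norm_sq_sum by (simp add: sum_distrib_left)
    also have "\<dots> = ?z * \<phi>1 ?R * ?R" using R by (simp add: power2_eq_square)
    finally show ?thesis by (simp add: algebra_simps)
  qed
  finally show ?thesis .
qed


section \<open>Function spaces, weak formulations and discontinuity\<close>

lemma AE_sg_pos: "AE x in lborel. 0 < sg x"
  using AE_coord_neq_0[of i1] by eventually_elim (simp add: sg_pos)

lemma bb_Lp: assumes "0 \<le> p" "(1 + d) * p < \<nu>" shows "bb \<in> Lp_on p (ball 0 (1/2))"
proof -
  have [measurable]: "bb \<in> borel_measurable borel" by (rule measurables)
  have bm: "(\<lambda>x. norm (bb x) powr p) \<in> borel_measurable borel" by measurable
  have "integrable lborel (\<lambda>x. indicator (ball 0 (1/2)) x *\<^sub>R (norm (bb x) powr p))"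
  proof (rule integrable_half_ball[where \<beta> = "(1 + d) * p" and C = "C0 powr p"])
    show "AE x in lborel. norm x < 1/2 \<longrightarrow> norm (norm (bb x) powr p) \<le> C0 powr p * norm x powr (- ((1 + d) * p))"
      using AE_sg_pos
    proof eventually_elim
      case (elim x)
      show ?case
      proof
        assume "norm x < 1/2"
        hence "norm (bb x) \<le> C0 * norm x powr (- (1 + d))" using bb_bound[of x] elim by simp
        hence "norm (bb x) powr p \<le> (C0 * norm x powr (- (1 + d))) powr p"
          using assms by (intro powr_mono2) auto
        also have "\<dots> = C0 powr p * norm x powr (- ((1 + d) * p))"
          using C0_pos by (simp add: powr_mult powr_powr algebra_simps)
        finally show "norm (norm (bb x) powr p) \<le> C0 powr p * norm x powr (- ((1 + d) * p))" by simp
      qed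
    qed
  qed (use assms d_pos \<nu>_card bm in auto)
  from has_bochner_integral_lebesgue_on_ball[OF has_bochner_integral_integrable[OF this]]
  have "integrable (lebesgue_on (ball 0 (1/2))) (\<lambda>x. norm (bb x) powr p)"
    by (simp add: has_bochner_integral_iff)
  thus ?thesis by (simp add: Lp_on_def borel_measurable_lebesgue_onI)
qed

lemma gu_integrable: "integrable lborel (\<lambda>x. indicator (ball 0 (1/2)) x *\<^sub>R gu x)"
proof (rule integrable_half_ball[where \<beta> = 1 and C = 4])
  show "AE x in lborel. norm x < 1/2 \<longrightarrow> norm (gu x) \<le> 4 * norm x powr - 1"
    using AE_sg_pos
  proof eventually_elim
    case (elim x)
    hence "x \<noteq> 0" by (auto simp: sg_def)
    thus ?case using gu_bound[of x] by (auto simp: powr_minus_divide)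
  qed
qed (use card_ge in auto)

lemma uu_integrable: "integrable lborel (\<lambda>x. indicator (ball 0 (1/2)) x *\<^sub>R uu x)"
proof (rule integrable_half_ball[where \<beta> = 0 and C = 2])
  show "AE x in lborel. norm x < 1/2 \<longrightarrow> norm (uu x) \<le> 2 * norm x powr - 0"
    using AE_sg_pos
  proof eventually_elim
    case (elim x)
    hence "x \<noteq> 0" by (auto simp: sg_def)
    thus ?case using uu_bound[of x] by auto
  qed
qed (use card_ge in auto)

lemma uu_Linf: "uu \<in> Linf_on (ball 0 (1/2))"
  unfolding Linf_on_def using uu_bound
  by (auto intro!: exI[of _ 2] AE_I2 borel_measurable_lebesgue_onI simp: space_restrict_space)

lemma gu_integration_by_parts: assumes h: "h \<in> test_functions (ball 0 (1/2))"
  shows "has_bochner_integral lborel (\<lambda>x. D2 i x * h x + gu x $ i * pd i h x) 0"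
    "has_bochner_integral lborel (\<lambda>x. gu x $ i * h x + uu x * pd i h x) 0"
proof -
  \<comment> \<open>Any other coordinate will do: \<open>uu\<close> is singular only at the origin,
    which every hyperplane \<open>x $ j = 0\<close> contains.\<close>
  obtain j where ij: "i \<noteq> j" using distinct by metis
  have ne: "x \<noteq> 0" if "x $ j \<noteq> 0" for x :: "real^'n" using that by auto
  have b: "\<bar>gu x $ i\<bar> \<le> 12 / norm x" if "x \<noteq> 0" "norm x < 1/2" for x
  proof -
    have "\<bar>gu x $ i\<bar> \<le> 4 / norm x"
      using gu_bound[of x] component_le_norm_cart[of "gu x" i] that by linarith
    also have "\<dots> \<le> 12 / norm x" by (intro divide_right_mono) auto
    finally show ?thesis .
  qed
  have [measurable]: "gu \<in> borel_measurable borel" by (rule measurables)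
  have gm: "(\<lambda>x. gu x $ i) \<in> borel_measurable borel"
  proof -
    have "(\<lambda>x. gu x \<bullet> e\<^sub>i i) \<in> borel_measurable borel" by measurable
    thus ?thesis by (simp add: inner_axis)
  qed
  show "has_bochner_integral lborel (\<lambda>x. D2 i x * h x + gu x $ i * pd i h x) 0"
    by (rule integration_by_parts_test[OF card_ge ij h, where C = 12])
      (use gu_line ne D2_bound b gm in auto)
  show "has_bochner_integral lborel (\<lambda>x. gu x $ i * h x + uu x * pd i h x) 0"
  proof (rule integration_by_parts_test[OF card_ge ij h, where C = 12])
    fix x :: "real^'n" assume x: "x $ j \<noteq> 0" "norm x < 1/2"
    have n: "0 < norm x" using x by auto
    show "\<bar>uu x\<bar> \<le> 12 / norm x"
    proof -
      have "\<bar>uu x\<bar> * norm x \<le> 2 * 1" using uu_bound[of x] x by (intro mult_mono) auto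
      thus ?thesis using n by (simp add: pos_le_divide_eq)
    qed
    have "12 / norm x \<le> 12 / (norm x)^2"
      using n x(2) by (intro divide_left_mono) (auto simp: power2_eq_square mult_left_le)
    thus "\<bar>gu x $ i\<bar> \<le> 12 / (norm x)^2" using b[OF ne[OF x(1)] x(2)] by linarith
  qed (use uu_line ne gm in auto)
qed

lemma weak_gradient: "weak_gradient_on (ball 0 (1/2)) uu gu"
  unfolding weak_gradient_on_def
proof (intro conjI ballI)
  show "locally_integrable_on uu (ball 0 (1/2))" "locally_integrable_on gu (ball 0 (1/2))"
    using locally_integrable_on_ball uu_integrable gu_integrable by blast+
  fix h :: "real^'n \<Rightarrow> real" assume h: "h \<in> test_functions (ball 0 (1/2))"
  obtain B1 where B1: "0 < B1" "\<And>x. norm (grad h x) \<le> B1" using grad_bounded[OF h] by blast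
  obtain B2 where B2: "0 < B2" "\<And>x. \<bar>h x\<bar> \<le> B2" using test_bounded[OF h] by blast
  note [measurable] = test_measurable[OF h] grad_measurable[OF h]
  have z: "h x = 0" "grad h x = 0" if "x \<notin> ball 0 (1/2)" for x
    using test_zero[OF h that] grad_zero[OF h that] by auto
  have I1: "integrable lborel (\<lambda>x. uu x *\<^sub>R grad h x)"
  proof (rule integrable_power_singularity[where \<beta> = 0 and C = "2 * B1"])
    show "AE x in lborel. norm x < 1 \<longrightarrow> norm (uu x *\<^sub>R grad h x) \<le> 2 * B1 * norm x powr - 0"
      using AE_sg_pos
    proof eventually_elim
      case (elim x)
      hence "x \<noteq> 0" by (auto simp: sg_def)
      thus ?case using uu_bound[of x] B1 by (auto intro!: mult_mono)
    qed
  qed (use z card_ge in auto)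
  have I2: "integrable lborel (\<lambda>x. h x *\<^sub>R gu x)"
  proof (rule integrable_power_singularity[where \<beta> = 1 and C = "B2 * 4"])
    show "AE x in lborel. norm x < 1 \<longrightarrow> norm (h x *\<^sub>R gu x) \<le> B2 * 4 * norm x powr - 1"
      using AE_sg_pos
    proof eventually_elim
      case (elim x)
      hence x: "x \<noteq> 0" by (auto simp: sg_def)
      have "\<bar>h x\<bar> * norm (gu x) \<le> B2 * (4 / norm x)" if "norm x < 1"
        using gu_bound[OF x] B2 that by (intro mult_mono) auto
      thus ?case by (simp add: powr_minus_divide)
    qed
  qed (use z card_ge in auto)
  have "(\<integral>x. uu x *\<^sub>R grad h x + h x *\<^sub>R gu x \<partial>lborel) $ i = 0" for i
  proof -
    have "(\<integral>x. uu x *\<^sub>R grad h x + h x *\<^sub>R gu x \<partial>lborel) $ i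
        = (\<integral>x. (uu x *\<^sub>R grad h x + h x *\<^sub>R gu x) $ i \<partial>lborel)"
      by (rule integral_bounded_linear[OF bounded_linear_vec_nth Bochner_Integration.integrable_add[OF I1 I2], symmetric])
    also have "\<dots> = (\<integral>x. gu x $ i * h x + uu x * pd i h x \<partial>lborel)"
      by (simp add: grad_nth algebra_simps)
    also have "\<dots> = 0" using gu_integration_by_parts(2)[OF h] by (simp add: has_bochner_integral_iff)
    finally show ?thesis .
  qed
  hence "(\<integral>x. uu x *\<^sub>R grad h x + h x *\<^sub>R gu x \<partial>lborel) = 0" by (simp add: vec_eq_iff)
  hence "(\<integral>x. uu x *\<^sub>R grad h x \<partial>lborel) = - (\<integral>x. h x *\<^sub>R gu x \<partial>lborel)"
    using Bochner_Integration.integral_add[OF I1 I2] by (simp add: eq_neg_iff_add_eq_0)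
  moreover have "(\<integral>x. uu x *\<^sub>R grad h x \<partial>lebesgue_on (ball 0 (1/2))) = (\<integral>x. uu x *\<^sub>R grad h x \<partial>lborel)"
    by (intro has_bochner_integral_integral_eq has_bochner_integral_lebesgue_on_ball_support
        has_bochner_integral_integrable I1) (simp add: z)
  moreover have "(\<integral>x. h x *\<^sub>R gu x \<partial>lebesgue_on (ball 0 (1/2))) = (\<integral>x. h x *\<^sub>R gu x \<partial>lborel)"
    by (intro has_bochner_integral_integral_eq has_bochner_integral_lebesgue_on_ball_support
        has_bochner_integral_integrable I2) (simp add: z)
  ultimately show "(\<integral>x. uu x *\<^sub>R grad h x \<partial>lebesgue_on (ball 0 (1/2)))
      = - (\<integral>x. h x *\<^sub>R gu x \<partial>lebesgue_on (ball 0 (1/2)))" by simp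
qed

lemma uu_W12: "uu \<in> W12_on (ball 0 (1/2))"
proof -
  have [measurable]: "gu \<in> borel_measurable borel" "uu \<in> borel_measurable borel" by (rule measurables)+
  have "integrable lborel (\<lambda>x. indicator (ball 0 (1/2)) x *\<^sub>R (norm (uu x) powr 2))"
  proof (rule integrable_half_ball[where \<beta> = 0 and C = 4])
    show "AE x in lborel. norm x < 1/2 \<longrightarrow> norm (norm (uu x) powr 2) \<le> 4 * norm x powr - 0"
      using AE_sg_pos
    proof eventually_elim
      case (elim x)
      hence x: "x \<noteq> 0" by (auto simp: sg_def)
      have "(uu x)^2 \<le> 4" if "norm x < 1/2"
        using power_mono[OF uu_bound[of x], of 2] that by simp
      thus ?case using x by auto
    qed
  qed (use card_ge in auto)
  from has_bochner_integral_lebesgue_on_ball[OF has_bochner_integral_integrable[OF this]]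
  have "uu \<in> Lp_on 2 (ball 0 (1/2))"
    by (simp add: has_bochner_integral_iff Lp_on_def borel_measurable_lebesgue_onI)
  moreover have "integrable lborel (\<lambda>x. indicator (ball 0 (1/2)) x *\<^sub>R (norm (gu x) powr 2))"
  proof (rule integrable_half_ball[where \<beta> = 2 and C = 16])
    show "AE x in lborel. norm x < 1/2 \<longrightarrow> norm (norm (gu x) powr 2) \<le> 16 * norm x powr - 2"
      using AE_sg_pos
    proof eventually_elim
      case (elim x)
      hence x: "x \<noteq> 0" by (auto simp: sg_def)
      have "(norm (gu x))^2 \<le> 16 / (norm x)^2" if "norm x < 1/2"
        using power_mono[OF gu_bound[OF x], of 2] that by (simp add: power_divide)
      thus ?case using x by (auto simp: powr_minus_divide)
    qed
  qed (use card_ge in auto)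
  from has_bochner_integral_lebesgue_on_ball[OF has_bochner_integral_integrable[OF this]]
  have "gu \<in> Lp_on 2 (ball 0 (1/2))"
    by (simp add: has_bochner_integral_iff Lp_on_def borel_measurable_lebesgue_onI)
  ultimately show ?thesis unfolding W12_on_def using weak_gradient by blast
qed

lemma bb_inner: "bb x \<bullet> y = bz x * y $ k - br x * (x $ i1 * y $ i1 + x $ i2 * y $ i2)"
  by (simp add: bb_def inner_diff_left inner_add_left inner_axis')

lemma div_free: "weakly_div_free_on (ball 0 (1/2)) bb"
  unfolding weakly_div_free_on_def
proof
  fix h :: "real^'n \<Rightarrow> real" assume h: "h \<in> test_functions (ball 0 (1/2))"
  have [measurable]: "bb \<in> borel_measurable borel" "br \<in> borel_measurable borel" by (rule measurables)+
  note [measurable] = grad_measurable[OF h] test_measurable[OF pd_test[OF h]]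
  \<comment> \<open>For each \<open>i\<close>, the derivative of \<open>G i\<close> in direction
    \<open>i\<close> is tested with \<open>pd k h\<close> and the one in direction \<open>k\<close>
    with \<open>pd i h\<close>. In the difference the mixed second derivatives of \<open>h\<close>
    cancel.\<close>
  have AB: "has_bochner_integral lborel (\<lambda>x. G' i x * pd k h x - x $ i * br x * pd i h x) 0"
    if ij: "i = i1 \<and> j = i2 \<or> i = i2 \<and> j = i1" for i j
  proof -
    have d: "i \<noteq> j" "k \<noteq> i" and i: "i = i1 \<or> i = i2" using ij distinct by auto
    have s: "0 < sg x" if "x $ i \<noteq> 0 \<or> x $ j \<noteq> 0" for x
      using that ij sg_pos by auto
    \<comment> \<open>The exceptional hyperplane is \<open>x $ j = 0\<close> for direction
      \<open>i\<close> and \<open>x $ i = 0\<close> for direction \<open>k\<close>. Both contain the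
      axis \<open>\<sigma> = 0\<close>, and each is parallel to its direction.\<close>
    have "has_bochner_integral lborel (\<lambda>x. G' i x * pd k h x + G i x * pd i (pd k h) x) 0"
      by (rule integration_by_parts_test[OF card_ge d(1) pd_test[OF h], where C = C0])
        (use G_line[OF i] potential_bounds(4,5)[OF _ _ i] s in auto)
    moreover have "has_bochner_integral lborel (\<lambda>x. x $ i * br x * pd i h x + G i x * pd k (pd i h) x) 0"
      by (rule integration_by_parts_test[OF card_ge d(2) pd_test[OF h], where C = C0])
        (use G_line_k[OF i] potential_bounds(3,4)[OF _ _ i] s in auto)
    ultimately have "has_bochner_integral lborel (\<lambda>x. (G' i x * pd k h x + G i x * pd i (pd k h) x)
        - (x $ i * br x * pd i h x + G i x * pd k (pd i h) x)) (0 - 0)"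
      by (rule has_bochner_integral_diff)
    thus ?thesis by (simp add: pd_commute[OF h, of i k])
  qed
  have sum0: "has_bochner_integral lborel (\<lambda>x. (G' i1 x * pd k h x - x $ i1 * br x * pd i1 h x)
      + (G' i2 x * pd k h x - x $ i2 * br x * pd i2 h x)) (0 + 0)"
    by (intro has_bochner_integral_add AB[of i1 i2] AB[of i2 i1]) auto
  have "has_bochner_integral lborel (\<lambda>x. bb x \<bullet> grad h x) (0 + 0)"
  proof (rule has_bochner_integral_AE[OF sum0])
    show "AE x in lborel. (G' i1 x * pd k h x - x $ i1 * br x * pd i1 h x)
      + (G' i2 x * pd k h x - x $ i2 * br x * pd i2 h x) = bb x \<bullet> grad h x"
      using AE_sg_pos
      by eventually_elim (simp add: bb_inner grad_nth algebra_simps flip: G'_sum)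
  qed measurable
  thus "has_bochner_integral (lebesgue_on (ball 0 (1/2))) (\<lambda>x. bb x \<bullet> grad h x) 0"
    using grad_zero[OF h] by (intro has_bochner_integral_lebesgue_on_ball_support) auto
qed

lemma solution: "weak_solution_on (ball 0 (1/2)) bb uu"
  unfolding weak_solution_on_def
proof (intro exI[of _ gu] conjI weak_gradient ballI)
  fix h :: "real^'n \<Rightarrow> real" assume h: "h \<in> test_functions (ball 0 (1/2))"
  have [measurable]: "bb \<in> borel_measurable borel" "gu \<in> borel_measurable borel" by (rule measurables)+
  note [measurable] = grad_measurable[OF h] test_measurable[OF h]
  have sum0: "has_bochner_integral lborel (\<lambda>x. \<Sum>i\<in>UNIV. D2 i x * h x + gu x $ i * pd i h x) (\<Sum>i\<in>(UNIV::'n set). 0)"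
    by (intro has_bochner_integral_sum gu_integration_by_parts h)
  have "has_bochner_integral lborel (\<lambda>x. gu x \<bullet> (grad h x + h x *\<^sub>R bb x)) (\<Sum>i\<in>(UNIV::'n set). 0)"
  proof (rule has_bochner_integral_AE[OF sum0])
    show "AE x in lborel. (\<Sum>i\<in>UNIV. D2 i x * h x + gu x $ i * pd i h x) = gu x \<bullet> (grad h x + h x *\<^sub>R bb x)"
      using AE_sg_pos
    proof eventually_elim
      case (elim x)
      have "gu x \<bullet> (grad h x + h x *\<^sub>R bb x) = gu x \<bullet> grad h x + h x * (\<Sum>i\<in>UNIV. D2 i x)"
        by (simp add: inner_add_right inner_gu_bb[OF elim])
      also have "gu x \<bullet> grad h x = (\<Sum>i\<in>UNIV. gu x $ i * pd i h x)"
        unfolding inner_cart grad_nth ..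
      finally show ?case by (simp add: sum.distrib sum_distrib_left mult.commute)
    qed
  qed measurable
  thus "has_bochner_integral (lebesgue_on (ball 0 (1/2))) (\<lambda>x. gu x \<bullet> (grad h x + h x *\<^sub>R bb x)) 0"
    using grad_zero[OF h] test_zero[OF h] by (intro has_bochner_integral_lebesgue_on_ball_support) auto
qed

lemma discontinuous: "\<not> ae_continuous_on (ball 0 (1/2)) uu"
proof
  assume "ae_continuous_on (ball 0 (1/2)) uu"
  then obtain v where v: "continuous_on (ball 0 (1/2)) v" and ae: "AE x in lebesgue_on (ball 0 (1/2)). uu x = v x"
    by (auto simp: ae_continuous_on_def)
  have "isCont v 0" using v by (simp add: continuous_on_eq_continuous_at)
  then obtain r where r: "0 < r" "\<And>x. norm x < r \<Longrightarrow> \<bar>v x - v 0\<bar> < 1/2"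
    by (auto simp: continuous_at_eps_delta dist_norm dest!: spec[of _ "1/2"])
  \<comment> \<open>The sign is chosen against that of \<open>v 0\<close>: near the origin
    \<open>c * v\<close> stays below \<open>1/2\<close>, while \<open>c * uu\<close> exceeds
    \<open>1/2\<close> on the part of a cone called \<open>A\<close>. Being open and nonempty,
    \<open>A\<close> cannot lie in the null set where \<open>uu\<close> and \<open>v\<close>
    differ.\<close>
  define c :: real where "c = (if v 0 \<le> 0 then 1 else -1)"
  define A where "A = {x::real^'n. norm x < min r (1/2) \<and> norm x / 2 < c * x $ k}"
  have "open A" unfolding A_def by (intro open_Collect_conj open_Collect_less continuous_intros) auto
  moreover have "(c * min r (1/2) / 2) *\<^sub>R e\<^sub>i k \<in> A"
  proof -
    have "norm (t *\<^sub>R e\<^sub>i k :: real^'n) = \<bar>t\<bar>" "(t *\<^sub>R e\<^sub>i k :: real^'n) $ k = t" for t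
      by (simp add: norm_axis_1) (simp add: axis_def)
    thus ?thesis unfolding A_def mem_Collect_eq using r(1) by (auto simp: c_def min_def)
  qed
  ultimately have nn: "\<not> negligible A" using open_not_negligible by blast
  have "AE x in lebesgue. x \<in> ball 0 (1/2) \<longrightarrow> uu x = v x"
    using ae by (subst (asm) AE_restrict_space_iff) auto
  then obtain N where N: "N \<in> null_sets lebesgue" "{x. \<not> (x \<in> ball 0 (1/2) \<longrightarrow> uu x = v x)} \<subseteq> N"
    unfolding eventually_ae_filter by auto
  have "A \<subseteq> N"
  proof
    fix x assume x: "x \<in> A"
    have n: "0 < norm x" using x by (auto simp: A_def zero_less_iff_neq_zero) 
    have "c * uu x = (c * x $ k / norm x) * (1 + norm x powr d)" by (simp add: uu_def U_def)
    moreover have "1/2 < c * x $ k / norm x" using x n by (simp add: A_def field_simps)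
    moreover have "1 \<le> 1 + norm x powr d" by simp
    ultimately have "1/2 * 1 < c * uu x" using mult_less_le_imp_less[of "1/2" "c * x $ k / norm x" 1 "1 + norm x powr d"] by simp
    moreover have "c * v x < 1/2"
      using r(2)[of x] x by (auto simp: A_def c_def abs_if split: if_splits)
    ultimately have "uu x \<noteq> v x" by auto
    thus "x \<in> N" using N(2) x by (auto simp: A_def)
  qed
  thus False using nn N(1) negligible_subset negligible_iff_null_sets by blast
qed

end

theorem theorem1p6:
  fixes p :: real
  assumes "CARD('n::finite) \<ge> 3" and "2 \<le> p" and "p < real CARD('n)"
  shows "\<exists>(b\<^sub>0 :: real ^ 'n \<Rightarrow> real ^ 'n) (u\<^sub>0 :: real ^ 'n \<Rightarrow> real).
           b\<^sub>0 \<in> Lp_on p (ball 0 (1/2)) \<and>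
           weakly_div_free_on (ball 0 (1/2)) b\<^sub>0 \<and>
           u\<^sub>0 \<in> W12_on (ball 0 (1/2)) \<inter> Linf_on (ball 0 (1/2)) \<and>
           weak_solution_on (ball 0 (1/2)) b\<^sub>0 u\<^sub>0 \<and>
           \<not> ae_continuous_on (ball 0 (1/2)) u\<^sub>0"
proof -
  let ?n = "real CARD('n)"
  \<comment> \<open>The second entry gives \<open>d * p \<le> (n - p) / 2\<close> with
    \<open>n\<close> the dimension, hence \<open>(1 + d) * p < n\<close>, the integrability
    condition for the \<open>p\<close>-th power of the drift.\<close>
  define d where "d = min (1/2) ((?n - p) / (2 * p))"
  have d: "0 < d" "d \<le> 1/2" using assms by (auto simp: d_def)
  have "d * p \<le> (?n - p) / (2 * p) * p" using assms by (intro mult_right_mono) (auto simp: d_def)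
  also have "\<dots> < ?n - p" using assms by simp
  finally have dp: "(1 + d) * p < ?n" by (simp add: algebra_simps)
  obtain T :: "'n set" where "card T = 3"
    using obtain_subset_with_card_n[OF assms(1)] by blast
  then obtain k i1 i2 :: 'n where "k \<noteq> i1" "k \<noteq> i2" "i1 \<noteq> i2" by (auto simp: card_3_iff)
  then interpret drift d ?n k i1 i2 using d assms by unfold_locales auto
  show ?thesis
    using bb_Lp[of p] dp assms div_free uu_W12 uu_Linf solution discontinuous
    by (intro exI[of _ bb] exI[of _ uu]) auto
qed

end
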